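(* Let $X$ be a separable Banach space, let $0 < T \leq \infty$, and suppose $F : [0,T) \times X \to \mathcal{P}(X)$ satisfies the following properties: (H1') $F$ is $\mathcal{L}[0,T) \otimes \mathcal{B}(X)$ measurable; (H2') for each $R > 0$ there exists $k_R \in L^1_{\mathrm{loc}}([0,T),\mathbb{R})$ such that, for almost every $t \in [0,T)$, $$d_H(F(t,\xi),F(t,\eta)) \leq k_R(t)\,|\xi-\eta| \qquad \text{for all } \xi,\eta \in B(0,R);$$ (H3') for each $R > 0$ there exists $\alpha_R \in L^1_{\mathrm{loc}}([0,T),\mathbb{R})$ such that, for almost every $t \in [0,T)$, $$\sup\{|\zeta| : \zeta \in F(t,\xi)\} \leq \alpha_R(t) \qquad \text{for all } \xi \in B(0,R).$$ Fix $\xi \in X$ and let $z : [0,T) \to X$ be a solution of $$\dot{x} \in \operatorname{clco} F(t,x), \qquad x(0) = \xi.$$ Let $r : [0,T) \to \mathbb{R}_{>0}$ be a continuous function. Then there exist some $\eta^0 \in B(\xi, r(0))$ and a solution $\gamma : [0,T) \to X$ of $$\dot{x} \in F(t,x), \qquad x(0) = \eta^0,$$ which satisfies $$|z(t)-\gamma(t)| \leq r(t) \qquad \text{for all } t \in [0,T).$$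
   Context: The norm of $X$ is denoted $|\cdot|$. $\mathcal{P}(X)$ is the family of all nonempty closed subsets of $X$; $\mathcal{B}(X)$ is the Borel $\sigma$-field of $X$; $\mathcal{L}[0,T)$ is the $\sigma$-field of Lebesgue measurable subsets of $[0,T)$. A set-valued map $F:[0,T)\times X\to\mathcal{P}(X)$ is $\mathcal{L}[0,T)\otimes\mathcal{B}(X)$ measurable if $\{(t,x) : F(t,x)\cap U \neq \emptyset\}$ belongs to the product $\sigma$-field $\mathcal{L}[0,T)\otimes\mathcal{B}(X)$ for every open $U\subseteq X$. $L^1_{\mathrm{loc}}([0,T),\mathbb{R})$ is the space of locally integrable functions (integrable on every compact subinterval of $[0,T)$). For $\xi\in X$ and $K\in\mathcal{P}(X)$, $d(\xi,K):=\inf\{|\xi-\eta| : \eta\in K\}$. For $r>0$, $B(\xi,r):=\{\eta\in X : |\eta-\xi|\le r\}$ is the closed ball. The Hausdorff distance between $K,L\in\mathcal{P}(X)$ is $d_H(K,L):=\max\{\sup_{\xi\in K}d(\xi,L),\ \sup_{\eta\in L}d(\eta,K)\}$. $\operatorname{clco}$ denotes the closed convex hull. For a set-valued map $G:[0,T)\times X\to\mathcal{P}(X)$, a solution on $[0,T)$ of the differential inclusion $\dot x\in G(t,x)$ is a function $x:[0,T)\to X$ that is absolutely continuous on each compact subinterval of $[0,T)$, in the sense that there is a locally Bochner integrable function $\dot x:[0,T)\to X$ with $x(t)=x(0)+\int_0^t\dot x(s)\,ds$ for all $t\in[0,T)$, and such that $\dot x(t)\in G(t,x(t))$ for almost every $t\in[0,T)$.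 A solution of the inclusion together with $x(0)=\xi$ is a solution with that initial value. *)

theory Defs
  imports "HOL-Analysis.Analysis"
begin

text \<open>The horizon is an extended real so that \<open>T = \<infinity>\<close> is allowed.\<close>

definition time_interval :: "ereal \<Rightarrow> real set" where
  "time_interval T = {t. 0 \<le> t \<and> ereal t < T}"

definition L1_loc :: "ereal \<Rightarrow> (real \<Rightarrow> 'a::{banach, second_countable_topology}) \<Rightarrow> bool" where
  "L1_loc T f \<longleftrightarrow>
     (\<forall>a\<in>time_interval T. \<forall>b\<in>time_interval T. a \<le> b \<longrightarrow> set_integrable lebesgue {a..b} f)"

text \<open>Extended-real valued, since a supremum over an unbounded set may be infinite (and the
  real-valued supremum of an unbounded set is unspecified).  Meant for nonempty arguments:
  the library sets \<open>infdist x {} = 0\<close>.\<close>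

definition hausdorff_dist :: "'a::metric_space set \<Rightarrow> 'a set \<Rightarrow> ereal" where
  "hausdorff_dist K L =
     max (SUP x\<in>K. ereal (infdist x L)) (SUP y\<in>L. ereal (infdist y K))"

definition clco :: "'a::real_normed_vector set \<Rightarrow> 'a set" where
  "clco S = closure (convex hull S)"

definition set_valued_measurable ::
    "ereal \<Rightarrow> (real \<Rightarrow> 'a::topological_space \<Rightarrow> 'a set) \<Rightarrow> bool" where
  "set_valued_measurable T F \<longleftrightarrow>
     (\<forall>U. open U \<longrightarrow>
        {(t, x). t \<in> time_interval T \<and> F t x \<inter> U \<noteq> {}}
          \<in> sets (lebesgue_on (time_interval T) \<Otimes>\<^sub>M borel))"

definition inclusion_solution ::
    "ereal \<Rightarrow> (real \<Rightarrow> 'a::{banach, second_countable_topology} \<Rightarrow> 'a set) \<Rightarrow> 'a \<Rightarrow> (real \<Rightarrow> 'a) \<Rightarrow> bool"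
  where
  "inclusion_solution T G \<xi> x \<longleftrightarrow>
     x 0 = \<xi> \<and>
     (\<exists>v. L1_loc T v \<and>
          (\<forall>t\<in>time_interval T. x t = x 0 + (LINT s:{0..t}|lebesgue. v s)) \<and>
          (AE t in lebesgue_on (time_interval T). v t \<in> G t (x t)))"

end

theory Submission
  imports Defs
begin

text \<open>
  The theorem is a relaxation theorem of Filippov--Wazewski type on a half-open, possibly unbounded
  interval. A trajectory of the convexified inclusion is followed by a chattering trajectory whose velocity
  alternates quickly between points near \<open>F (t, z t)\<close>, and this is corrected to an exact solution by
  Filippov's successive approximations. On \<open>[0, T)\<close> errors that are propagated forward from \<open>t = 0\<close> may grow
  without control, whereas the tolerance \<open>r\<close> may tend to 0 arbitrarily fast. The freedom in the initial value
  resolves this: all corrections are integrated from the right end point, so that the error at time \<open>t\<close> is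
  an integral over \<open>[t, T)\<close>, and the initial value is whatever results. Thus a single fixed-point
  argument on all of \<open>[0, T)\<close> suffices, without gluing solutions on compact subintervals.

  Three ingredients carry the proof. Lemma \<open>decaying_weight\<close> constructs a nonincreasing \<open>\<delta> \<le> r\<close> that decays so
  fast that the integral of \<open>k \<delta>\<close> over \<open>[t, T)\<close> is at most \<open>\<delta> t / 8\<close>, where \<open>k\<close> bounds growth and Lipschitz
  constant of \<open>F\<close> near \<open>z\<close>. With this weight, Filippov's iteration contracts (lemma
  \<open>filippov_from_right_end\<close>).

  Lemma \<open>chattering_approximation\<close> provides the starting point. The velocity of \<open>z\<close> is approximated
  by iterated midpoints of points from a countable dense set, and the times at which one particular midpoint is
  used are halved repeatedly, so that the mean value over a short piece of time is reproduced exactly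
  (lemma \<open>mean_by_splitting\<close>). Only the unfinished piece around \<open>t\<close> contributes an error at time \<open>t\<close>, and the
  pieces, which are level sets of a primitive, are short enough for it to be at most \<open>\<delta> t / 8\<close>
  (lemma \<open>level_set_integral\<close>).

  Measurable selections are obtained by choosing the first suitable point of a dense sequence
  (lemma \<open>measurable_countable_choice\<close>). This only gives points near a set, but it suffices since the
  values of \<open>F\<close> are closed and exact membership is needed only for the limit of the iteration.
\<close>

section \<open>Measurable choices with countably many values\<close>

text \<open>Picking the first admissible index is measurable. Since all approximate selections below take their
  values in a countable set, this replaces the Kuratowski--Ryll-Nardzewski selection theorem: exact
  membership in the closed values of a multifunction is only reached in the limit.\<close>

lemma measurable_countable_choice:
  fixes P :: "'i::countable \<Rightarrow> 'b \<Rightarrow> bool"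
  assumes P: "\<And>i. {x \<in> space M. P i x} \<in> sets M"
  obtains c where "c \<in> M \<rightarrow>\<^sub>M count_space UNIV"
    and "\<And>x. (\<exists>i. P i x) \<Longrightarrow> P (c x) x"
proof
  define p where "p = (\<lambda>n x. (\<exists>i. to_nat i = n \<and> P i x))"
  define c where "c = (\<lambda>x. from_nat (LEAST n. p n x) :: 'i)"
  have "{x \<in> space M. p n x} = (\<Union>i\<in>{i. to_nat i = n}. {x \<in> space M. P i x})" for n
    by (auto simp: p_def)
  then have "{x \<in> space M. p n x} \<in> sets M" for n
    using P by (auto intro!: sets.countable_UN')
  then have [measurable]: "\<And>n. (\<lambda>x. p n x) \<in> M \<rightarrow>\<^sub>M count_space UNIV"
    by (simp add: pred_def)
  show "c \<in> M \<rightarrow>\<^sub>M count_space UNIV"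
    unfolding c_def by measurable
  show "P (c x) x" if "\<exists>i. P i x" for x
  proof -
    have "\<exists>n. p n x" using that by (auto simp: p_def)
    then have "p (LEAST n. p n x) x" by (rule LeastI_ex)
    then obtain i where "to_nat i = (LEAST n. p n x)" "P i x" by (auto simp: p_def)
    then show ?thesis by (metis c_def from_nat_to_nat)
  qed
qed

lemma dense_sequence:
  obtains d :: "nat \<Rightarrow> 'a::{metric_space, second_countable_topology}"
  where "\<And>x e. e > 0 \<Longrightarrow> \<exists>n. dist (d n) x < e"
proof -
  obtain D :: "'a set" where "countable D" and D: "\<And>X. open X \<Longrightarrow> X \<noteq> {} \<Longrightarrow> \<exists>y\<in>D. y \<in> X"
    by (rule countable_dense_setE) blast
  show ?thesis
  proof (rule that[of "from_nat_into D"])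
    fix x :: 'a and e :: real assume "e > 0"
    then have "\<exists>y\<in>D. y \<in> ball x e" by (intro D) auto
    then obtain y where "y \<in> D" "dist y x < e" by (auto simp: dist_commute)
    then show "\<exists>n. dist (from_nat_into D n) x < e"
      by (metis \<open>countable D\<close> from_nat_into_surj)
  qed
qed

section \<open>Iterated midpoints and the closed convex hull\<close>

text \<open>A tree records how a point is formed from the terms of a sequence by taking midpoints repeatedly.
  Restricting convex combinations to iterated midpoints keeps their number countable, and makes them
  realisable by cutting sets in half.\<close>

datatype mtree = Leaf nat | Node mtree mtree

instance mtree :: countable
  by countable_datatype

primrec leaves :: "mtree \<Rightarrow> nat set" where
  "leaves (Leaf n) = {n}"
| "leaves (Node a b) = leaves a \<union> leaves b"

primrec mean :: "(nat \<Rightarrow> 'a::real_vector) \<Rightarrow> mtree \<Rightarrow> 'a" where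
  "mean d (Leaf n) = d n"
| "mean d (Node a b) = (1/2) *\<^sub>R (mean d a + mean d b)"

lemma finite_leaves: "finite (leaves \<tau>)"
  by (induction \<tau>) auto

lemma clco_subset_cball:
  assumes "\<And>w. w \<in> S \<Longrightarrow> norm w \<le> b"
  shows "clco S \<subseteq> cball (0::'a::real_normed_vector) b"
  unfolding clco_def using assms by (intro closure_minimal hull_minimal) (auto simp: dist_norm)

text \<open>On a segment with end points in \<open>C\<close>, the parameters that lead into \<open>C\<close> form a closed set containing
  0 and 1. A parameter outside this set would lie in a maximal gap, but the midpoint of the gap belongs
  to the set.\<close>

lemma convex_closed_midpoints:
  fixes C :: "'a::real_normed_vector set"
  assumes cl: "closed C" and mid: "\<And>x y. x \<in> C \<Longrightarrow> y \<in> C \<Longrightarrow> (1/2) *\<^sub>R (x + y) \<in> C"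
  shows "convex C"
proof (rule ccontr)
  assume "\<not> convex C"
  then obtain x y p where xy: "x \<in> C" "y \<in> C" and p: "0 \<le> p" "p \<le> 1"
    and np: "(1 - p) *\<^sub>R x + p *\<^sub>R y \<notin> C"
    unfolding convex_alt by blast
  define g where "g = (\<lambda>p::real. (1 - p) *\<^sub>R x + p *\<^sub>R y)"
  have cont: "continuous_on S g" for S
    unfolding g_def by (intro continuous_intros)
  define B where "B = g -` C"
  have clB: "closed B"
    unfolding B_def by (rule closed_vimage[OF cl cont])
  have g01: "g 0 = x" "g 1 = y" by (auto simp: g_def)
  have B01: "0 \<in> B" "1 \<in> B" using xy by (auto simp: B_def g01)
  have midB: "(a + b) / 2 \<in> B" if "a \<in> B" "b \<in> B" for a b
  proof -
    have "(1/2) *\<^sub>R (g a + g b) = ((1 - a)/2 + (1 - b)/2) *\<^sub>R x + (a/2 + b/2) *\<^sub>R y"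
      unfolding g_def by (simp add: scaleR_add_left scaleR_add_right)
    also have "(1 - a)/2 + (1 - b)/2 = 1 - (a + b)/2" by (simp add: field_simps)
    also have "a/2 + b/2 = (a + b)/2" by (simp add: field_simps)
    finally have "g ((a + b) / 2) = (1/2) *\<^sub>R (g a + g b)" unfolding g_def by simp
    then show ?thesis using mid[of "g a" "g b"] that by (auto simp: B_def)
  qed
  have pB: "p \<notin> B" using np by (auto simp: B_def g_def)
  define a where "a = Sup (B \<inter> {0..p})"
  define b where "b = Inf (B \<inter> {p..1})"
  have "a \<in> B \<inter> {0..p}"
    unfolding a_def using B01 p by (intro closed_contains_Sup) (auto intro: closed_Int clB)
  moreover have "b \<in> B \<inter> {p..1}"
    unfolding b_def using B01 p by (intro closed_contains_Inf) (auto intro: closed_Int clB)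
  ultimately have ab: "a \<in> B" "b \<in> B" "0 \<le> a" "a < p" "p < b" "b \<le> 1"
    using pB by (auto simp: order_less_le)
  let ?m = "(a + b) / 2"
  have "?m \<in> B" using midB ab by auto
  show False
  proof (cases "?m \<le> p")
    case True
    then have "?m \<in> B \<inter> {0..p}" using \<open>?m \<in> B\<close> ab by auto
    then have "?m \<le> a" unfolding a_def by (intro cSup_upper) auto
    then show False using ab by auto
  next
    case False
    then have "?m \<in> B \<inter> {p..1}" using \<open>?m \<in> B\<close> ab by auto
    then have "b \<le> ?m" unfolding b_def by (intro cInf_lower) auto
    then show False using ab by auto
  qed
qed

text \<open>The iterated midpoints of those terms of the dense sequence that are near \<open>S\<close> have a closure which
  is closed under midpoints, hence convex, and which contains \<open>S\<close>. It therefore contains the closed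
  convex hull.\<close>

lemma clco_approx_mean:
  fixes S :: "'a::{real_normed_vector} set"
  assumes d: "\<And>x e. e > 0 \<Longrightarrow> \<exists>n. dist (d n) x < e"
    and x: "x \<in> clco S" and e: "e > 0"
  shows "\<exists>\<tau>. (\<forall>n\<in>leaves \<tau>. infdist (d n) S < e) \<and> norm (mean d \<tau> - x) < e"
proof -
  define V where "V = {mean d \<tau> | \<tau>. \<forall>n\<in>leaves \<tau>. infdist (d n) S < e}"
  have midV: "(1/2) *\<^sub>R (x + y) \<in> V" if xy: "x \<in> V" "y \<in> V" for x y
  proof -
    obtain a b where "x = mean d a" "y = mean d b"
      "\<forall>n\<in>leaves a. infdist (d n) S < e" "\<forall>n\<in>leaves b. infdist (d n) S < e"
      using xy unfolding V_def by blast
    then show ?thesis unfolding V_def by (intro CollectI exI[of _ "Node a b"]) auto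
  qed
  have "(1/2) *\<^sub>R (x + y) \<in> closure V" if xy: "x \<in> closure V" "y \<in> closure V" for x y
  proof -
    obtain f g where "\<forall>n. f n \<in> V" "f \<longlonglongrightarrow> x" "\<forall>n. g n \<in> V" "g \<longlonglongrightarrow> y"
      using xy unfolding closure_sequential by blast
    then show ?thesis unfolding closure_sequential
      by (intro exI[of _ "\<lambda>n. (1/2) *\<^sub>R (f n + g n)"]) (auto intro!: midV tendsto_intros)
  qed
  then have "convex (closure V)" by (intro convex_closed_midpoints) auto
  moreover have "S \<subseteq> closure V"
  proof
    fix s assume "s \<in> S"
    show "s \<in> closure V" unfolding closure_approachable
    proof safe
      fix e' :: real assume "e' > 0"
      then obtain n where n: "dist (d n) s < min e e'" using d[of "min e e'" s] e by auto
      then have "infdist (d n) S < e" using infdist_le[OF \<open>s \<in> S\<close>, of "d n"] by auto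
      then have "d n \<in> V" unfolding V_def by (intro CollectI exI[of _ "Leaf n"]) auto
      then show "\<exists>y\<in>V. dist y s < e'" using n by auto
    qed
  qed
  ultimately have "clco S \<subseteq> closure V"
    unfolding clco_def by (intro closure_minimal hull_minimal) auto
  then have "x \<in> closure V" using x by blast
  then obtain y where "y \<in> V" "dist y x < e"
    using e unfolding closure_approachable by blast
  then show ?thesis unfolding V_def dist_norm by auto
qed

section \<open>Splitting sets of finite measure\<close>

text \<open>The measure of the part of \<open>A\<close> to the left of a point is a Lipschitz function of the point, so it
  takes the value half way by the intermediate value theorem.\<close>

lemma halve_measure:
  fixes A :: "real set"
  assumes A: "A \<in> sets lebesgue" and AB: "A \<subseteq> {a..b}"
  obtains B where "B \<in> sets lebesgue" "B \<subseteq> A" "measure lebesgue B = measure lebesgue A / 2"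
    "measure lebesgue (A - B) = measure lebesgue A / 2"
proof -
  have lm: "A \<inter> S \<in> lmeasurable" if "S \<in> sets lebesgue" for S
    using that A AB
    by (intro bounded_set_imp_lmeasurable bounded_subset[OF bounded_closed_interval[of a b]]) auto
  define m where "m = (\<lambda>t. measure lebesgue (A \<inter> {..t}))"
  have m_step: "m s \<le> m t \<and> m t - m s \<le> t - s" if "s \<le> t" for s t
  proof -
    have sub: "A \<inter> {..s} \<subseteq> A \<inter> {..t}" using that by auto
    have "m t - m s = measure lebesgue (A \<inter> {..t} - A \<inter> {..s})"
      unfolding m_def using sub lm by (intro measurable_measure_Diff[symmetric]) (auto simp: fmeasurableD)
    also have "A \<inter> {..t} - A \<inter> {..s} = A \<inter> {s<..t}" by auto
    finally have eq: "m t - m s = measure lebesgue (A \<inter> {s<..t})" .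
    have "measure lebesgue (A \<inter> {s<..t}) \<le> measure lebesgue {s<..t}"
      by (intro measure_mono_fmeasurable fmeasurableD lm) (auto intro: bounded_set_imp_lmeasurable)
    then show ?thesis using eq that measure_nonneg[of lebesgue "A \<inter> {s<..t}"]
      by (simp del: measure_nonneg)
  qed
  have "\<bar>m s - m t\<bar> \<le> \<bar>s - t\<bar>" for s t
    using m_step[of s t] m_step[of t s] by (cases "s \<le> t") auto
  then have "1-lipschitz_on UNIV m"
    by (intro lipschitz_onI) (auto simp: dist_real_def)
  then have cont: "continuous_on S m" for S
    by (meson continuous_on_subset lipschitz_on_continuous_on subset_UNIV)
  show ?thesis
  proof (cases "a \<le> b")
    case False
    then have "A = {}" using AB by auto
    then show ?thesis using that[of "{}"] by auto
  next
    case True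
    have "A \<inter> {..b} = A" using AB by auto
    then have mb: "m b = measure lebesgue A" by (simp add: m_def)
    have "A \<inter> {..a} \<subseteq> {a}" using AB by auto
    then have "m a \<le> measure lebesgue {a}"
      unfolding m_def using lm[of "{..a}"] bounded_set_imp_lmeasurable[of "{a}"]
      by (intro measure_mono_fmeasurable) (auto simp: fmeasurableD)
    then have ma: "m a = 0" using measure_nonneg[of lebesgue "A \<inter> {..a}"] by (simp add: m_def)
    have "\<exists>t. a \<le> t \<and> t \<le> b \<and> m t = measure lebesgue A / 2"
      using True mb ma by (intro IVT' cont) auto
    then obtain t where t: "m t = measure lebesgue A / 2" by blast
    show ?thesis
    proof (rule that[of "A \<inter> {..t}"])
      have "measure lebesgue (A - A \<inter> {..t}) = measure lebesgue A - m t"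
        unfolding m_def using lm[of UNIV] lm by (intro measurable_measure_Diff) (auto simp: fmeasurableD)
      then show "measure lebesgue (A - A \<inter> {..t}) = measure lebesgue A / 2" using t by simp
    qed (use A t in \<open>auto simp: m_def\<close>)
  qed
qed

text \<open>This exchanges convexification in space for alternation in time: halving \<open>A\<close> at every inner node of
  the tree produces a function that takes only the values at the leaves and has over \<open>A\<close> exactly the
  same integral as the constant iterated midpoint.\<close>

lemma mean_by_splitting:
  fixes d :: "nat \<Rightarrow> 'a::{banach, second_countable_topology}" and A :: "real set"
  assumes "A \<in> sets lebesgue" "A \<subseteq> {a..b}"
  shows "\<exists>w. w \<in> borel_measurable lebesgue \<and> (\<forall>t. w t \<in> d ` leaves \<tau>) \<and>
    set_integrable lebesgue A w \<and> (LINT t:A|lebesgue. w t) = measure lebesgue A *\<^sub>R mean d \<tau>"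
  using assms
proof (induction \<tau> arbitrary: A)
  case (Leaf n)
  have "A \<in> lmeasurable"
    using bounded_subset[OF bounded_closed_interval Leaf.prems(2)] Leaf.prems(1)
    by (rule bounded_set_imp_lmeasurable)
  then show ?case
    by (intro exI[of _ "\<lambda>_. d n"])
      (auto simp: set_integrable_def set_lebesgue_integral_def fmeasurable_def)
next
  case (Node \<tau>1 \<tau>2)
  obtain B where B: "B \<in> sets lebesgue" "B \<subseteq> A" "measure lebesgue B = measure lebesgue A / 2"
    "measure lebesgue (A - B) = measure lebesgue A / 2"
    using halve_measure[OF Node.prems] by blast
  obtain w1 where w1: "w1 \<in> borel_measurable lebesgue" "\<forall>t. w1 t \<in> d ` leaves \<tau>1"
    "set_integrable lebesgue B w1" "(LINT t:B|lebesgue. w1 t) = measure lebesgue B *\<^sub>R mean d \<tau>1"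
    using Node.IH(1)[of B] B Node.prems by auto
  obtain w2 where w2: "w2 \<in> borel_measurable lebesgue" "\<forall>t. w2 t \<in> d ` leaves \<tau>2"
    "set_integrable lebesgue (A - B) w2"
    "(LINT t:A - B|lebesgue. w2 t) = measure lebesgue (A - B) *\<^sub>R mean d \<tau>2"
    using Node.IH(2)[of "A - B"] B Node.prems by auto
  define w where "w = (\<lambda>t. if t \<in> B then w1 t else w2 t)"
  have wm: "w \<in> borel_measurable lebesgue"
    unfolding w_def using w1(1) w2(1) B(1) by (intro measurable_If_set) auto
  have c1: "set_integrable lebesgue B w = set_integrable lebesgue B w1"
    "(LINT t:B|lebesgue. w t) = (LINT t:B|lebesgue. w1 t)"
    by (auto simp: w_def set_integrable_def set_lebesgue_integral_def indicator_def
        intro!: Bochner_Integration.integrable_cong Bochner_Integration.integral_cong)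
  have c2: "set_integrable lebesgue (A - B) w = set_integrable lebesgue (A - B) w2"
    "(LINT t:A - B|lebesgue. w t) = (LINT t:A - B|lebesgue. w2 t)"
    by (auto simp: w_def set_integrable_def set_lebesgue_integral_def indicator_def
        intro!: Bochner_Integration.integrable_cong Bochner_Integration.integral_cong)
  have AB: "A = B \<union> (A - B)" using B by auto
  have "set_integrable lebesgue (B \<union> (A - B)) w"
    using c1 c2 w1 w2 B Node.prems by (intro set_integrable_Un) auto
  moreover have "(LINT t:B \<union> (A - B)|lebesgue. w t) = measure lebesgue A *\<^sub>R mean d (Node \<tau>1 \<tau>2)"
    using c1 c2 w1 w2 B by (subst set_integral_Un) (auto simp: algebra_simps)
  ultimately show ?case using AB wm w1(2) w2(2)
    by (intro exI[of _ w]) (auto simp: w_def)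
qed

section \<open>Locally integrable functions on a half-open interval\<close>

lemma time_interval_borel [measurable, simp]: "time_interval T \<in> sets borel"
proof (cases T)
  case (real r)
  then have "time_interval T = {0..<r}" by (auto simp: time_interval_def)
  then show ?thesis by simp
next
  case PInf
  then have "time_interval T = {0..}" by (auto simp: time_interval_def)
  then show ?thesis by simp
next
  case MInf
  then have "time_interval T = {}" by (auto simp: time_interval_def)
  then show ?thesis by simp
qed

lemma time_interval_lebesgue [measurable, simp]: "time_interval T \<in> sets lebesgue"
  by simp

lemma Icc_subset_time_interval: "t \<in> time_interval T \<Longrightarrow> 0 \<le> a \<Longrightarrow> {a..t} \<subseteq> time_interval T"
  unfolding time_interval_def by (auto intro: le_less_trans[OF ereal_less_eq(3)[THEN iffD2]])

lemma time_interval_nonneg: "t \<in> time_interval T \<Longrightarrow> 0 \<le> t"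
  by (simp add: time_interval_def)

lemma time_interval_down: "t \<in> time_interval T \<Longrightarrow> 0 \<le> s \<Longrightarrow> s \<le> t \<Longrightarrow> s \<in> time_interval T"
  using Icc_subset_time_interval[of t T 0] by auto

lemma zero_time_interval: "0 < T \<Longrightarrow> 0 \<in> time_interval T"
  by (auto simp: time_interval_def zero_ereal_def)

lemma time_interval_exhaustion:
  assumes "0 < T"
  obtains c :: "nat \<Rightarrow> real" where "mono c" "\<And>n. c n \<in> time_interval T"
    "time_interval T = (\<Union>n. {0..c n})"
proof (cases T)
  case (real r)
  define c where "c = (\<lambda>n::nat. r * (1 - 1 / real (Suc n)))"
  have r: "r > 0" using assms real by simp
  have cI: "c n \<in> time_interval T" for n
    using r real unfolding time_interval_def c_def by (auto simp: field_simps)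
  have "time_interval T = (\<Union>n. {0..c n})"
  proof safe
    fix t assume t: "t \<in> time_interval T"
    then have "0 \<le> t" "t < r" using real by (auto simp: time_interval_def)
    then obtain n where "1 / real (Suc n) < (r - t) / r"
      using r reals_Archimedean[of "(r - t) / r"] by (auto simp: inverse_eq_divide)
    then have "t \<le> c n" using r unfolding c_def by (simp add: field_simps)
    then show "t \<in> (\<Union>n. {0..c n})" using \<open>0 \<le> t\<close> by auto
  qed (use Icc_subset_time_interval[OF cI] in fastforce)
  moreover have "mono c"
    unfolding mono_def c_def using r by (auto intro!: mult_left_mono divide_left_mono)
  ultimately show ?thesis using that cI by blast
next
  case PInf
  have "t \<in> (\<Union>n. {0..real n})" if "0 \<le> t" for t
    using that real_arch_simple[of t] by auto
  then have "time_interval T = (\<Union>n. {0..real n})" using PInf by (auto simp: time_interval_def)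
  then show ?thesis using PInf by (intro that[of real]) (auto simp: mono_def time_interval_def)
next
  case MInf
  then show ?thesis using assms by simp
qed

lemma set_integrable_dominated:
  fixes f :: "real \<Rightarrow> 'a::{banach, second_countable_topology}"
  assumes f: "f \<in> borel_measurable (lebesgue_on (time_interval T))"
    and A: "A \<in> sets lebesgue" "A \<subseteq> time_interval T"
    and g: "set_integrable lebesgue A g"
    and le: "AE t in lebesgue_on (time_interval T). t \<in> A \<longrightarrow> norm (f t) \<le> g t"
  shows "set_integrable lebesgue A f"
    and "norm (LINT t:A|lebesgue. f t) \<le> (LINT t:A|lebesgue. g t)"
proof -
  let ?I = "time_interval T"
  have "(\<lambda>t. indicator ?I t *\<^sub>R f t) \<in> borel_measurable lebesgue"
    using f by (subst (asm) borel_measurable_restrict_space_iff) auto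
  then have "(\<lambda>t. indicator A t *\<^sub>R (indicator ?I t *\<^sub>R f t)) \<in> borel_measurable lebesgue"
    by (rule borel_measurable_scaleR[OF borel_measurable_indicator[OF A(1)]])
  also have "(\<lambda>t. indicator A t *\<^sub>R (indicator ?I t *\<^sub>R f t)) = (\<lambda>t. indicator A t *\<^sub>R f t)"
    using A by (intro ext) (auto simp: indicator_def)
  finally have m: "(\<lambda>t. indicator A t *\<^sub>R f t) \<in> borel_measurable lebesgue" .
  have le': "AE t in lebesgue. t \<in> ?I \<longrightarrow> t \<in> A \<longrightarrow> norm (f t) \<le> g t"
    using le by (subst (asm) AE_restrict_space_iff) auto
  show int: "set_integrable lebesgue A f"
    unfolding set_integrable_def
  proof (rule Bochner_Integration.integrable_bound[OF g[unfolded set_integrable_def] m])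
    show "AE t in lebesgue. norm (indicator A t *\<^sub>R f t) \<le> norm (indicator A t *\<^sub>R g t)"
      using le' by eventually_elim (use A in \<open>auto simp: indicator_def\<close>)
  qed
  have "norm (LINT t:A|lebesgue. f t) \<le> (LINT t:A|lebesgue. norm (f t))"
    by (rule set_integral_norm_bound[OF int])
  also have "\<dots> \<le> (LINT t:A|lebesgue. g t)"
  proof (rule set_integral_mono_AE[OF set_integrable_norm[OF int] g])
    show "AE t\<in>A in lebesgue. norm (f t) \<le> g t"
      using le' by eventually_elim (use A in auto)
  qed
  finally show "norm (LINT t:A|lebesgue. f t) \<le> (LINT t:A|lebesgue. g t)" .
qed

lemma L1_locD:
  assumes "L1_loc T f" "t \<in> time_interval T"
  shows "set_integrable lebesgue {0..t} f"
  using assms time_interval_down[OF assms(2), of 0] time_interval_nonneg[OF assms(2)]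
  unfolding L1_loc_def by auto

lemma L1_locI:
  assumes "\<And>t. t \<in> time_interval T \<Longrightarrow> set_integrable lebesgue {0..t} f"
  shows "L1_loc T f"
  unfolding L1_loc_def
proof safe
  fix a b assume "a \<in> time_interval T" "b \<in> time_interval T" "a \<le> b"
  then show "set_integrable lebesgue {a..b} f"
    using set_integrable_subset[OF assms[of b], of "{a..b}"] time_interval_nonneg[of a] by auto
qed

lemma L1_loc_measurable:
  assumes "0 < T" "L1_loc T f"
  shows "f \<in> borel_measurable (lebesgue_on (time_interval T))"
proof -
  obtain c :: "nat \<Rightarrow> real" where c: "mono c" "\<And>n. c n \<in> time_interval T" "time_interval T = (\<Union>n. {0..c n})"
    using time_interval_exhaustion[OF assms(1)] by blast
  show ?thesis
  proof (rule measurable_piecewise_restrict[where C = "range (\<lambda>n. {0..c n})"])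
    show "space (lebesgue_on (time_interval T)) \<subseteq> \<Union> (range (\<lambda>n. {0..c n}))"
      using c(3) by simp
    fix \<Omega> assume "\<Omega> \<in> range (\<lambda>n. {0..c n})"
    then obtain n where \<Omega>: "\<Omega> = {0..c n}" by auto
    then have sub: "\<Omega> \<subseteq> time_interval T" using c(3) by auto
    show "\<Omega> \<inter> space (lebesgue_on (time_interval T)) \<in> sets (lebesgue_on (time_interval T))"
      using sub \<Omega> by (auto simp: sets_restrict_space)
    have "f \<in> borel_measurable (lebesgue_on \<Omega>)"
      using L1_locD[OF assms(2) c(2)[of n]] \<Omega> unfolding set_integrable_def
      by (subst borel_measurable_restrict_space_iff) auto
    then show "f \<in> borel_measurable (restrict_space (lebesgue_on (time_interval T)) \<Omega>)"
      using sub \<Omega> by (subst restrict_restrict_space) (auto simp: Int_absorb1)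
  qed auto
qed

lemma L1_loc_dominated:
  fixes f :: "real \<Rightarrow> 'a::{banach, second_countable_topology}"
  assumes "f \<in> borel_measurable (lebesgue_on (time_interval T))" "L1_loc T g"
    and "AE t in lebesgue_on (time_interval T). norm (f t) \<le> g t"
  shows "L1_loc T f"
proof (rule L1_locI)
  fix t assume t: "t \<in> time_interval T"
  show "set_integrable lebesgue {0..t} f"
    by (rule set_integrable_dominated(1)[OF assms(1) _ _ L1_locD[OF assms(2) t]])
      (use Icc_subset_time_interval[OF t] assms(3) in auto)
qed

lemma L1_loc_add:
  "L1_loc T f \<Longrightarrow> L1_loc T g \<Longrightarrow> L1_loc T (\<lambda>t. f t + g t)"
  "L1_loc T f \<Longrightarrow> L1_loc T g \<Longrightarrow> L1_loc T (\<lambda>t. f t - g t)"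
  unfolding L1_loc_def by auto

lemma L1_loc_norm: "L1_loc T f \<Longrightarrow> L1_loc T (\<lambda>t. norm (f t))"
  unfolding L1_loc_def by (auto intro: set_integrable_norm)

lemma L1_loc_const: "L1_loc T (\<lambda>_. c :: real)"
  unfolding L1_loc_def using lmeasurable_cbox by (auto intro!: absolutely_integrable_on_const)

lemma set_integral_singleton [simp]:
  fixes f :: "real \<Rightarrow> 'a::{banach, second_countable_topology}"
  shows "(LINT s:{a}|lebesgue. f s) = 0"
  unfolding set_lebesgue_integral_def
proof (rule integral_eq_zero_AE)
  show "AE s in lebesgue. indicator {a} s *\<^sub>R f s = 0"
    by (rule AE_I'[of "{a}"]) (auto simp: indicator_def null_sets_def)
qed

lemma L1_loc_split:
  assumes f: "L1_loc T f" and ab: "b \<in> time_interval T" "0 \<le> a" "a \<le> b"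
  shows "(LINT s:{0..b}|lebesgue. f s) = (LINT s:{0..a}|lebesgue. f s) + (LINT s:{a<..b}|lebesgue. f s)"
proof -
  have "{0..b} = {0..a} \<union> {a<..b}" using ab by auto
  moreover have "(LINT s:{0..a} \<union> {a<..b}|lebesgue. f s)
      = (LINT s:{0..a}|lebesgue. f s) + (LINT s:{a<..b}|lebesgue. f s)"
    using ab by (intro set_integral_Un set_integrable_subset[OF L1_locD[OF f ab(1)]]) auto
  ultimately show ?thesis by simp
qed

lemma continuous_primitive:
  fixes f x :: "real \<Rightarrow> 'a::{banach, second_countable_topology}" and c :: 'a
  assumes f: "L1_loc T f" and x: "\<And>t. t \<in> time_interval T \<Longrightarrow> x t = c + (LINT s:{0..t}|lebesgue. f s)"
  shows "continuous_on (time_interval T) x"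
proof -
  let ?N = "\<lambda>t. integral {0..t} (\<lambda>s. norm (f s))"
  have N: "L1_loc T (\<lambda>s. norm (f s))" by (rule L1_loc_norm[OF f])
  have int: "set_integrable lebesgue {0..t} (\<lambda>s. norm (f s))" if "t \<in> time_interval T" for t
    by (rule L1_locD[OF N that])
  have key: "norm (x b - x a) \<le> ?N b - ?N a" if "a \<in> time_interval T" "b \<in> time_interval T" "a \<le> b" for a b
  proof -
    have a0: "0 \<le> a" using that by (simp add: time_interval_nonneg)
    have "norm (x b - x a) = norm (LINT s:{a<..b}|lebesgue. f s)"
      using L1_loc_split[OF f that(2) a0 that(3)] x that by simp
    also have "\<dots> \<le> (LINT s:{a<..b}|lebesgue. norm (f s))"
      using a0 by (intro set_integral_norm_bound set_integrable_subset[OF L1_locD[OF f that(2)]]) auto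
    also have "\<dots> = ?N b - ?N a"
      using L1_loc_split[OF N that(2) a0 that(3)] set_lebesgue_integral_eq_integral(2)[OF int[OF that(1)]]
        set_lebesgue_integral_eq_integral(2)[OF int[OF that(2)]] by simp
    finally show ?thesis .
  qed
  have key': "dist (x b) (x a) \<le> dist (?N b) (?N a)"
    if "a \<in> time_interval T" "b \<in> time_interval T" for a b
    using key[of a b] key[of b a] that
    by (cases "a \<le> b") (auto simp: dist_norm norm_minus_commute)
  show ?thesis
    unfolding continuous_on_eq_continuous_within
  proof
    fix a assume a: "a \<in> time_interval T"
    have "\<exists>b\<in>time_interval T. \<exists>e>0. \<forall>t\<in>time_interval T. dist t a < e \<longrightarrow> t \<le> b"
    proof (cases "\<exists>b\<in>time_interval T. a < b")
      case True
      then obtain b where "b \<in> time_interval T" "a < b" by blast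
      then show ?thesis by (intro bexI[of _ b] exI[of _ "b - a"]) (auto simp: dist_real_def)
    next
      case False
      then show ?thesis using a by (intro bexI[of _ a] exI[of _ 1]) (auto simp: not_less)
    qed
    then obtain b e where b: "b \<in> time_interval T" "e > 0"
      "\<And>t. t \<in> time_interval T \<Longrightarrow> dist t a < e \<Longrightarrow> t \<le> b" by blast
    have "continuous_on {0..b} ?N"
      by (intro indefinite_integral_continuous_1 set_lebesgue_integral_eq_integral(1) int b)
    moreover have "a \<in> {0..b}" using b(3)[OF a] b(2) a by (auto simp: time_interval_nonneg)
    ultimately have cN: "continuous (at a within {0..b}) ?N" 
      by (simp add: continuous_on_eq_continuous_within)
    show "continuous (at a within time_interval T) x"
      unfolding continuous_within_eps_delta
    proof safe
      fix \<epsilon> :: real assume "\<epsilon> > 0"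
      then obtain d where d: "d > 0" "\<And>t. t \<in> {0..b} \<Longrightarrow> dist t a < d \<Longrightarrow> dist (?N t) (?N a) < \<epsilon>"
        using cN unfolding continuous_within_eps_delta by blast
      show "\<exists>d>0. \<forall>t\<in>time_interval T. dist t a < d \<longrightarrow> dist (x t) (x a) < \<epsilon>"
      proof (intro exI[of _ "min d e"] conjI ballI impI)
        fix t assume t: "t \<in> time_interval T" "dist t a < min d e"
        then have "t \<in> {0..b}" using b(3) by (auto simp: time_interval_nonneg)
        then show "dist (x t) (x a) < \<epsilon>" using d(2)[of t] key'[OF a t(1)] t(2) by auto
      qed (use d b in auto)
    qed
  qed
qed

lemma continuous_measurable_lebesgue_on:
  fixes f :: "real \<Rightarrow> 'a::{banach, second_countable_topology}"
  assumes "continuous_on (time_interval T) f"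
  shows "f \<in> borel_measurable (lebesgue_on (time_interval T))"
proof -
  have "f \<in> borel_measurable (restrict_space borel (time_interval T))"
    by (rule borel_measurable_continuous_on_restrict[OF assms])
  then have "(\<lambda>t. indicator (time_interval T) t *\<^sub>R f t) \<in> borel_measurable borel"
    by (subst (asm) borel_measurable_restrict_space_iff) auto
  then have "(\<lambda>t. indicator (time_interval T) t *\<^sub>R f t) \<in> borel_measurable lebesgue"
    by (simp add: measurable_completion)
  then show ?thesis
    by (subst borel_measurable_restrict_space_iff) auto
qed

lemma antimono_measurable_lebesgue_on:
  fixes f :: "real \<Rightarrow> real"
  assumes "antimono_on (time_interval T) f"
  shows "f \<in> borel_measurable (lebesgue_on (time_interval T))"
proof -
  have "mono_on (time_interval T) (\<lambda>t. - f t)"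
    using assms by (auto simp: monotone_on_def)
  then have "(\<lambda>t. - f t) \<in> borel_measurable (restrict_space borel (time_interval T))"
    by (intro borel_measurable_mono_on_fnc) auto
  then have "(\<lambda>t. - (- f t)) \<in> borel_measurable (restrict_space borel (time_interval T))"
    by (rule borel_measurable_uminus)
  then have "(\<lambda>t. indicator (time_interval T) t *\<^sub>R f t) \<in> borel_measurable borel"
    by (subst (asm) borel_measurable_restrict_space_iff) auto
  then have "(\<lambda>t. indicator (time_interval T) t *\<^sub>R f t) \<in> borel_measurable lebesgue"
    by (simp add: measurable_completion)
  then show ?thesis
    by (subst borel_measurable_restrict_space_iff) auto
qed

lemma set_integral_mono_subset:
  fixes f :: "'b \<Rightarrow> real"
  assumes B: "set_integrable M B f" and A: "A \<in> sets M" "A \<subseteq> B" and f: "\<And>t. t \<in> B \<Longrightarrow> 0 \<le> f t"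
  shows "(LINT t:A|M. f t) \<le> (LINT t:B|M. f t)"
  unfolding set_lebesgue_integral_def
  using B set_integrable_subset[OF B A] A f
  by (intro integral_mono) (auto simp: set_integrable_def indicator_def)

text \<open>Monotone convergence along an exhaustion of the time interval: for a nonnegative function,
  integrability up to the right end point follows from bounds over the compact subintervals.\<close>

lemma set_integrable_exhaustion:
  fixes f :: "real \<Rightarrow> real"
  assumes "0 < T" and f: "L1_loc T f" "\<And>t. t \<in> A \<Longrightarrow> 0 \<le> f t"
    and A: "A \<in> sets lebesgue" "A \<subseteq> time_interval T"
    and B: "\<And>b. b \<in> time_interval T \<Longrightarrow> (LINT t:A \<inter> {0..b}|lebesgue. f t) \<le> B"
  shows "set_integrable lebesgue A f" "(LINT t:A|lebesgue. f t) \<le> B"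
proof -
  obtain c :: "nat \<Rightarrow> real" where c: "mono c" "\<And>n. c n \<in> time_interval T" "time_interval T = (\<Union>n. {0..c n})"
    using time_interval_exhaustion[OF assms(1)] by blast
  define A' where "A' n = A \<inter> {0..c n}" for n
  have UA: "(\<Union>n. A' n) = A" using A c(3) by (auto simp: A'_def)
  have monoA: "mono A'" using c(1) unfolding A'_def mono_def by (force intro: order_trans)
  have mA: "A' n \<in> sets lebesgue" for n using A by (auto simp: A'_def)
  have intA: "set_integrable lebesgue (A' n) f" for n
    using set_integrable_subset[OF L1_locD[OF f(1) c(2)[of n]] mA[of n]] by (auto simp: A'_def)
  have "incseq (\<lambda>n. LINT t:A' n|lebesgue. f t)"
  proof (rule incseq_SucI)
    fix n
    have "A' n \<subseteq> A' (Suc n)" using monoA by (auto simp: mono_def)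
    then show "(LINT t:A' n|lebesgue. f t) \<le> (LINT t:A' (Suc n)|lebesgue. f t)"
      using f(2) mA by (intro set_integral_mono_subset[OF intA]) (auto simp: A'_def)
  qed
  then obtain L where L: "(\<lambda>n. LINT t:A' n|lebesgue. f t) \<longlonglongrightarrow> L" 
    using B c(2) by (auto intro: incseq_convergent[of _ B] simp: A'_def)
  have "set_integrable lebesgue (\<Union>n. A' n) f"
    using f(2) by (intro pos_integrable_to_top[OF mA monoA _ intA L]) (auto simp: A'_def)
  moreover from this have "(\<lambda>n. LINT t:A' n|lebesgue. f t) \<longlonglongrightarrow> (LINT t:(\<Union>n. A' n)|lebesgue. f t)"
    using monoA by (intro set_integral_cont_up mA) (auto simp: mono_iff_le_Suc)
  moreover have "(LINT t:A' n|lebesgue. f t) \<le> B" for n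
    using B[OF c(2)[of n]] by (simp add: A'_def)
  ultimately show "set_integrable lebesgue A f" "(LINT t:A|lebesgue. f t) \<le> B"
    unfolding UA by (auto intro: LIMSEQ_le_const2)
qed

section \<open>Integrals over level sets of a primitive\<close>

text \<open>The level sets of \<open>\<lfloor>H t\<rfloor>\<close> cut the time interval into consecutive pieces over which \<open>h\<close> has integral
  at most 1, because \<open>H\<close> is continuous and increases by at most 1 along each of them. Cutting at level
  sets avoids choosing the cutting points, of which there may be finitely or infinitely many.\<close>

lemma level_set_integral:
  fixes h :: "real \<Rightarrow> real"
  assumes T: "0 < T" and h: "L1_loc T h" "\<And>t. t \<in> time_interval T \<Longrightarrow> 0 \<le> h t"
    and H_def: "H = (\<lambda>t. LINT s:{0..t}|lebesgue. h s)"
    and S_def: "S = (\<lambda>j::nat. {t \<in> time_interval T. nat \<lfloor>H t\<rfloor> = j})"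
  shows "S j \<in> sets lebesgue" "set_integrable lebesgue (S j) h" "(LINT t:S j|lebesgue. h t) \<le> 1"
    and "\<And>s t. s \<in> time_interval T \<Longrightarrow> t \<in> time_interval T \<Longrightarrow> s \<le> t \<Longrightarrow> H s \<le> H t"
    and "\<And>t. t \<in> time_interval T \<Longrightarrow> 0 \<le> H t"
proof -
  let ?I = "time_interval T"
  have contH: "continuous_on ?I H"
    by (rule continuous_primitive[OF h(1), where c = 0]) (simp add: H_def)
  have diff: "(LINT s:{a..b}|lebesgue. h s) = H b - H a" if "a \<in> ?I" "b \<in> ?I" "a \<le> b" for a b
  proof -
    have int: "h integrable_on {0..b}" 
      by (rule set_lebesgue_integral_eq_integral(1)[OF L1_locD[OF h(1) that(2)]])
    have "(LINT s:{a..b}|lebesgue. h s) = integral {a..b} h"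
      using h(1) that by (intro set_lebesgue_integral_eq_integral(2)) (auto simp: L1_loc_def)
    moreover have "integral {0..a} h + integral {a..b} h = integral {0..b} h"
      using that time_interval_nonneg[of a T] by (intro Henstock_Kurzweil_Integration.integral_combine int) auto
    ultimately show ?thesis
      unfolding H_def using set_lebesgue_integral_eq_integral(2)[OF L1_locD[OF h(1) that(1)]]
        set_lebesgue_integral_eq_integral(2)[OF L1_locD[OF h(1) that(2)]] by simp
  qed
  show mono: "H s \<le> H t" if "s \<in> ?I" "t \<in> ?I" "s \<le> t" for s t
  proof -
    have "0 \<le> (LINT s:{s..t}|lebesgue. h s)"
      unfolding set_lebesgue_integral_def using that h(2) Icc_subset_time_interval[OF that(2), of s]
      by (intro Bochner_Integration.integral_nonneg) (auto simp: indicator_def time_interval_nonneg)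
    then show ?thesis using diff[OF that] by simp
  qed
  show H0: "0 \<le> H t" if "t \<in> ?I" for t
    unfolding H_def set_lebesgue_integral_def using that h(2) Icc_subset_time_interval[OF that, of 0]
    by (intro Bochner_Integration.integral_nonneg) (auto simp: indicator_def)
  have "H \<in> borel_measurable (lebesgue_on ?I)"
    by (rule continuous_measurable_lebesgue_on[OF contH])
  then have "(\<lambda>t. nat \<lfloor>H t\<rfloor>) \<in> lebesgue_on ?I \<rightarrow>\<^sub>M count_space UNIV"
    by measurable
  then have "(\<lambda>t. nat \<lfloor>H t\<rfloor>) -` {j} \<inter> space (lebesgue_on ?I) \<in> sets (lebesgue_on ?I)"
    by (rule measurable_sets) auto
  moreover have "(\<lambda>t. nat \<lfloor>H t\<rfloor>) -` {j} \<inter> space (lebesgue_on ?I) = S j"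
    by (auto simp: S_def)
  ultimately show mS: "S j \<in> sets lebesgue"
    by (subst (asm) sets_restrict_space_iff) auto
  have Sj: "real j \<le> H t \<and> H t \<le> real j + 1" if "t \<in> S j" for t
    using that H0[of t] unfolding S_def by (auto simp: nat_eq_iff) linarith+
  have SI: "S j \<subseteq> ?I" by (auto simp: S_def)
  have bound: "(LINT t:S j \<inter> {0..b}|lebesgue. h t) \<le> 1" if b: "b \<in> ?I" for b
  proof (cases "S j \<inter> {0..b} = {}")
    case True
    then show ?thesis by (simp add: set_lebesgue_integral_def)
  next
    case False
    have subI: "{0..b} \<subseteq> ?I" using Icc_subset_time_interval[OF b] by simp
    \<comment> \<open>The closed level strip attains its end points, unlike the half-open level set itself.\<close>
    define C where "C = {0..b} \<inter> H -` {real j..real j + 1}"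
    have "closed C" unfolding C_def
      by (intro continuous_closed_preimage continuous_on_subset[OF contH subI]) auto
    have CI: "C \<subseteq> ?I" using subI by (auto simp: C_def)
    have sub: "S j \<inter> {0..b} \<subseteq> C" using Sj by (auto simp: C_def)
    have bdd: "bdd_below C" "bdd_above C"
      by (rule bdd_below.I[of _ 0] bdd_above.I[of _ b], simp add: C_def)+
    have "C \<noteq> {}" using False sub by auto
    define p where "p = Inf C"
    define q where "q = Sup C"
    have p: "p \<in> C" unfolding p_def
      by (rule closed_contains_Inf[OF \<open>C \<noteq> {}\<close> bdd(1) \<open>closed C\<close>])
    have q: "q \<in> C" unfolding q_def
      by (rule closed_contains_Sup[OF \<open>C \<noteq> {}\<close> bdd(2) \<open>closed C\<close>])
    have pq: "C \<subseteq> {p..q}" 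
      unfolding p_def q_def using bdd by (auto intro: cInf_lower cSup_upper)
    then have "p \<le> q" using p by auto
    have pI: "p \<in> ?I" "q \<in> ?I" using p q CI by auto
    have "(LINT t:S j \<inter> {0..b}|lebesgue. h t) \<le> (LINT t:{p..q}|lebesgue. h t)"
    proof (rule set_integral_mono_subset)
      show "set_integrable lebesgue {p..q} h" using h(1) pI \<open>p \<le> q\<close> by (auto simp: L1_loc_def)
      show "0 \<le> h t" if "t \<in> {p..q}" for t
        using that Icc_subset_time_interval[OF pI(2), of p] pI(1) by (intro h(2)) (auto simp: time_interval_nonneg)
    qed (use sub pq mS in auto)
    also have "\<dots> = H q - H p" by (rule diff[OF pI \<open>p \<le> q\<close>])
    also have "\<dots> \<le> 1" using p q by (auto simp: C_def)
    finally show ?thesis .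
  qed
  show "set_integrable lebesgue (S j) h" "(LINT t:S j|lebesgue. h t) \<le> 1"
    using set_integrable_exhaustion[OF T h(1) _ mS SI bound] h(2) SI by blast+
qed

section \<open>Rapidly decaying weights\<close>

lemma geometric_tail_sum:
  "(\<Sum>j\<in>{n..<N}. (1/2)^j) \<le> 2 * (1/2 :: real)^n"
proof -
  have "(\<Sum>j\<in>{n..<N}. (1/2 :: real)^j) = (if n < N then 2 * ((1/2)^n - (1/2)^N) else 0)"
    by (induction N) (auto simp: less_Suc_eq not_less field_simps)
  then show ?thesis by simp
qed

text \<open>With \<open>H t = 16 * (integral of k over {0..t})\<close>, the function \<open>\<delta> t = \<rho> t * 2 ^ (- \<lfloor>H t\<rfloor>)\<close> has the
  required property: on the level set of value \<open>j\<close> the integral of \<open>k\<close> is at most 1/16, and the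
  resulting geometric series that starts at \<open>j = \<lfloor>H t\<rfloor>\<close> is at most \<open>\<delta> t / 8\<close>. This is a step version of
  the weight \<open>\<rho> t * exp (- H t)\<close>, for which one would need the chain rule for absolutely continuous
  functions.\<close>

lemma decaying_weight:
  fixes k \<rho> :: "real \<Rightarrow> real"
  assumes T: "0 < T" and k: "L1_loc T k" "\<And>t. t \<in> time_interval T \<Longrightarrow> 0 \<le> k t"
    and \<rho>: "antimono_on (time_interval T) \<rho>" "\<And>t. t \<in> time_interval T \<Longrightarrow> 0 < \<rho> t"
  obtains \<delta> where "antimono_on (time_interval T) \<delta>"
    and "\<And>t. t \<in> time_interval T \<Longrightarrow> 0 < \<delta> t \<and> \<delta> t \<le> \<rho> t"
    and "\<And>t. t \<in> time_interval T \<Longrightarrow> set_integrable lebesgue (time_interval T \<inter> {t..}) (\<lambda>s. k s * \<delta> s)"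
    and "\<And>t. t \<in> time_interval T \<Longrightarrow>
           (LINT s:time_interval T \<inter> {t..}|lebesgue. k s * \<delta> s) \<le> \<delta> t / 8"
proof
  let ?I = "time_interval T"
  define h where "h = (\<lambda>t. 16 * k t)"
  have h: "L1_loc T h" "\<And>t. t \<in> ?I \<Longrightarrow> 0 \<le> h t"
    using k unfolding h_def L1_loc_def by auto
  define H where "H = (\<lambda>t. LINT s:{0..t}|lebesgue. h s)"
  define S where "S = (\<lambda>j::nat. {t \<in> ?I. nat \<lfloor>H t\<rfloor> = j})"
  note L = level_set_integral[OF T h H_def S_def]
  define \<delta> where "\<delta> = (\<lambda>t. \<rho> t * (1/2)^(nat \<lfloor>H t\<rfloor>))"
  show pos: "0 < \<delta> t \<and> \<delta> t \<le> \<rho> t" if "t \<in> ?I" for t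
    using \<rho>(2)[OF that] by (simp add: \<delta>_def mult_le_cancel_left1 power_le_one)
  show anti: "antimono_on ?I \<delta>"
  proof (rule monotone_onI)
    fix s t assume st: "s \<in> ?I" "t \<in> ?I" "s \<le> t"
    have "nat \<lfloor>H s\<rfloor> \<le> nat \<lfloor>H t\<rfloor>" by (intro nat_mono floor_mono L(4) st)
    moreover have "\<rho> t \<le> \<rho> s" using \<rho>(1) st by (auto simp: monotone_on_def)
    ultimately show "\<delta> s \<ge> \<delta> t"
      unfolding \<delta>_def using \<rho>(2)[OF st(1)] \<rho>(2)[OF st(2)] 
      by (intro mult_mono power_decreasing) auto
  qed
  have loc: "L1_loc T (\<lambda>s. k s * \<delta> s)"
  proof (rule L1_loc_dominated)
    show "(\<lambda>s. k s * \<delta> s) \<in> borel_measurable (lebesgue_on ?I)"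
      using L1_loc_measurable[OF T k(1)] antimono_measurable_lebesgue_on[OF anti] by measurable
    show "L1_loc T (\<lambda>s. \<rho> 0 * k s)" using k(1) by (auto simp: L1_loc_def)
    show "AE t in lebesgue_on ?I. norm (k t * \<delta> t) \<le> \<rho> 0 * k t"
    proof (rule AE_I2)
      fix t assume "t \<in> space (lebesgue_on ?I)"
      then have t: "t \<in> ?I" by simp
      have "\<rho> t \<le> \<rho> 0" using \<rho>(1) t zero_time_interval[OF T] time_interval_nonneg[OF t]
        by (auto simp: monotone_on_def)
      then have "\<delta> t \<le> \<rho> 0" using pos[OF t] by simp
      then show "norm (k t * \<delta> t) \<le> \<rho> 0 * k t"
        using k(2)[OF t] pos[OF t] by (simp add: abs_mult mult.commute mult_right_mono)
    qed
  qed
  fix t assume t: "t \<in> ?I"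
  define A where "A = ?I \<inter> {t..}"
  have A: "A \<in> sets lebesgue" "A \<subseteq> ?I" by (auto simp: A_def)
  have nn: "0 \<le> k s * \<delta> s" if "s \<in> ?I" for s
    using k(2)[OF that] pos[OF that] by auto
  define n where "n = nat \<lfloor>H t\<rfloor>"
  have bound: "(LINT s:A \<inter> {0..b}|lebesgue. k s * \<delta> s) \<le> \<delta> t / 8" if b: "b \<in> ?I" for b
  proof -
    define N where "N = Suc (nat \<lfloor>H b\<rfloor>)"
    define W where "W = (\<lambda>j. S j \<inter> (A \<inter> {0..b}))"
    have mW: "W j \<in> sets lebesgue" for j
      unfolding W_def using L(1)[of j] A(1) by (intro sets.Int) auto
    have "A \<inter> {0..b} = (\<Union>j\<in>{n..<N}. W j)"
    proof -
      have "nat \<lfloor>H s\<rfloor> \<in> {n..<N}" if "s \<in> A \<inter> {0..b}" for s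
        using that t b unfolding n_def N_def A_def
        by (auto simp: less_Suc_eq_le intro!: nat_mono floor_mono L(4))
      then show ?thesis by (auto simp: W_def S_def A_def)
    qed
    then have "(LINT s:A \<inter> {0..b}|lebesgue. k s * \<delta> s) = (LINT s:(\<Union>j\<in>{n..<N}. W j)|lebesgue. k s * \<delta> s)"
      by simp
    also have "\<dots> = (\<Sum>j\<in>{n..<N}. LINT s:W j|lebesgue. k s * \<delta> s)"
      using mW by (intro set_integral_finite_Union set_integrable_subset[OF L1_locD[OF loc b]])
        (auto simp: disjoint_family_on_def W_def S_def)
    also have "\<dots> \<le> (\<Sum>j\<in>{n..<N}. \<rho> t * (1/2)^j / 16)"
    proof (rule sum_mono)
      fix j
      have ik: "set_integrable lebesgue (W j) k"
        using mW by (intro set_integrable_subset[OF L1_locD[OF k(1) b]]) (auto simp: W_def)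
      have ih: "set_integrable lebesgue (W j) h" using ik by (auto simp: h_def)
      have "(LINT s:W j|lebesgue. k s * \<delta> s) \<le> (LINT s:W j|lebesgue. (\<rho> t * (1/2)^j / 16) * h s)"
      proof (rule set_integral_mono)
        show "set_integrable lebesgue (W j) (\<lambda>s. k s * \<delta> s)"
          using mW by (intro set_integrable_subset[OF L1_locD[OF loc b]]) (auto simp: W_def)
        show "set_integrable lebesgue (W j) (\<lambda>s. (\<rho> t * (1/2)^j / 16) * h s)" using ih by auto
        fix s assume s: "s \<in> W j"
        then have "s \<in> ?I" "t \<le> s" "nat \<lfloor>H s\<rfloor> = j" by (auto simp: W_def A_def S_def)
        moreover have "\<rho> s \<le> \<rho> t" using \<rho>(1) calculation t by (auto simp: monotone_on_def)
        ultimately have "\<delta> s \<le> \<rho> t * (1/2)^j" by (auto simp: \<delta>_def)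
        then have "k s * \<delta> s \<le> k s * (\<rho> t * (1/2)^j)" 
          using k(2)[OF \<open>s \<in> ?I\<close>] by (intro mult_left_mono)
        then show "k s * \<delta> s \<le> (\<rho> t * (1/2)^j / 16) * h s" by (simp add: h_def mult_ac)
      qed
      also have "\<dots> = (\<rho> t * (1/2)^j / 16) * (LINT s:W j|lebesgue. h s)"
        by (rule set_integral_mult_right)
      also have "(LINT s:W j|lebesgue. h s) \<le> (LINT s:S j|lebesgue. h s)"
        using h(2) mW by (intro set_integral_mono_subset[OF L(2)]) (auto simp: W_def S_def)
      also have "\<dots> \<le> 1" by (rule L(3))
      finally show "(LINT s:W j|lebesgue. k s * \<delta> s) \<le> \<rho> t * (1/2)^j / 16"
        using \<rho>(2)[OF t] by (simp add: mult_left_mono)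
    qed
    also have "\<dots> = \<rho> t / 16 * (\<Sum>j\<in>{n..<N}. (1/2)^j)" by (simp add: sum_distrib_left)
    also have "\<dots> \<le> \<rho> t / 16 * (2 * (1/2)^n)"
      using \<rho>(2)[OF t] by (intro mult_left_mono geometric_tail_sum) auto
    also have "\<dots> = \<delta> t / 8" by (simp add: \<delta>_def n_def)
    finally show ?thesis .
  qed
  show "set_integrable lebesgue (?I \<inter> {t..}) (\<lambda>s. k s * \<delta> s)"
    "(LINT s:?I \<inter> {t..}|lebesgue. k s * \<delta> s) \<le> \<delta> t / 8"
    using set_integrable_exhaustion[OF T loc _ A bound] nn A unfolding A_def by blast+
qed

section \<open>Distances to sets and geometric limits\<close>

lemma infdist_le_excess:
  assumes "A \<noteq> {}" "\<And>a. a \<in> A \<Longrightarrow> infdist a B \<le> c"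
  shows "infdist u B \<le> infdist u A + c"
proof -
  have "infdist u B - c \<le> dist u a" if "a \<in> A" for a
    using infdist_triangle[of u B a] assms(2)[OF that] by simp
  then have "infdist u B - c \<le> infdist u A"
    unfolding infdist_notempty[OF assms(1)] by (intro cINF_greatest assms(1)) auto
  then show ?thesis by simp
qed

lemma infdist_less_obtain:
  assumes "infdist x A < e" "A \<noteq> {}"
  obtains a where "a \<in> A" "dist x a < e"
proof -
  have "(INF a\<in>A. dist x a) < e" using assms by (simp add: infdist_notempty)
  then show ?thesis using assms(2) that by (subst (asm) cINF_less_iff) (auto intro: bdd_below.I[of _ 0])
qed

lemma geometric_limit:
  fixes f :: "nat \<Rightarrow> 'a::banach"
  assumes step: "\<And>n. norm (f (Suc n) - f n) \<le> a * (1/2)^n"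
  obtains l where "f \<longlonglongrightarrow> l" "\<And>n. norm (l - f n) \<le> 2 * a * (1/2)^n"
proof -
  have a: "0 \<le> a" using order_trans[OF norm_ge_zero step[of 0]] by simp
  have tail: "norm (f (n + m) - f n) \<le> 2 * a * ((1/2)^n - (1/2)^(n + m))" for n m
  proof (induction m)
    case (Suc m)
    have "norm (f (n + Suc m) - f n) \<le> norm (f (Suc (n + m)) - f (n + m)) + norm (f (n + m) - f n)"
      using norm_triangle_ineq[of "f (Suc (n + m)) - f (n + m)" "f (n + m) - f n"] by simp
    also have "\<dots> \<le> a * (1/2)^(n + m) + 2 * a * ((1/2)^n - (1/2)^(n + m))"
      by (intro add_mono step Suc)
    also have "\<dots> = 2 * a * ((1/2)^n - (1/2)^(n + Suc m))" by (simp add: algebra_simps)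
    finally show ?case .
  qed auto
  have tail': "norm (f (n + m) - f n) \<le> 2 * a * (1/2)^n" for n m
    using a by (intro order_trans[OF tail[of n m]] mult_left_mono) auto
  have "summable (\<lambda>n. f (Suc n) - f n)"
    by (rule summable_comparison_test'[where g = "\<lambda>n. a * (1/2)^n" and N = 0])
      (auto intro!: step summable_mult summable_geometric)
  then have "convergent (\<lambda>n. \<Sum>i<n. f (Suc i) - f i)" by (simp add: summable_iff_convergent)
  then have "convergent (\<lambda>n. f n - f 0)" by (simp add: sum_lessThan_telescope)
  then obtain b where "(\<lambda>n. f n - f 0) \<longlonglongrightarrow> b" by (auto simp: convergent_def)
  from tendsto_add[OF this tendsto_const[of "f 0"]] have l: "f \<longlonglongrightarrow> b + f 0" by simp
  have "norm (b + f 0 - f n) \<le> 2 * a * (1/2)^n" for n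
  proof (rule LIMSEQ_le_const2)
    show "(\<lambda>m. norm (f m - f n)) \<longlonglongrightarrow> norm (b + f 0 - f n)"
      by (intro tendsto_intros l)
    show "\<exists>N. \<forall>m\<ge>N. norm (f m - f n) \<le> 2 * a * (1/2)^n"
      using tail'[of n] by (metis le_iff_add)
  qed
  then show ?thesis using that l by blast
qed

section \<open>Corrections integrated from the right end\<close>

text \<open>Here \<open>k\<close> dominates both the values and the Lipschitz constant of a multifunction, and \<open>\<delta>\<close> is the width
  of the tube in which solutions are sought. The bound on the integral of \<open>k * \<delta>\<close> over the remaining time
  says that an error of size \<open>\<delta>\<close>, amplified by \<open>k\<close> and integrated from the right end, is an eighth of
  \<open>\<delta>\<close> again.\<close>

locale tail_weight =
  fixes T :: ereal and k \<delta> :: "real \<Rightarrow> real"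
  assumes T_pos: "0 < T"
    and k_loc: "L1_loc T k"
    and k_ge1: "\<And>t. t \<in> time_interval T \<Longrightarrow> 1 \<le> k t"
    and \<delta>_anti: "antimono_on (time_interval T) \<delta>"
    and \<delta>_pos: "\<And>t. t \<in> time_interval T \<Longrightarrow> 0 < \<delta> t"
    and \<delta>_le1: "\<And>t. t \<in> time_interval T \<Longrightarrow> \<delta> t \<le> 1"
    and tail_int: "\<And>t. t \<in> time_interval T \<Longrightarrow>
      set_integrable lebesgue (time_interval T \<inter> {t..}) (\<lambda>s. k s * \<delta> s)"
    and tail_le: "\<And>t. t \<in> time_interval T \<Longrightarrow>
      (LINT s:time_interval T \<inter> {t..}|lebesgue. k s * \<delta> s) \<le> \<delta> t / 8"
begin

abbreviation "I \<equiv> time_interval T"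

lemma k_measurable [measurable]: "k \<in> borel_measurable (lebesgue_on I)"
  by (rule L1_loc_measurable[OF T_pos k_loc])

lemma \<delta>_measurable [measurable]: "\<delta> \<in> borel_measurable (lebesgue_on I)"
  by (rule antimono_measurable_lebesgue_on[OF \<delta>_anti])

lemma \<delta>_le_k\<delta>: "t \<in> I \<Longrightarrow> \<delta> t \<le> k t * \<delta> t"
  using k_ge1[of t] \<delta>_pos[of t] by simp

lemma k\<delta>_pos: "t \<in> I \<Longrightarrow> 0 < k t * \<delta> t"
  using k_ge1[of t] \<delta>_pos[of t] by simp

lemma k\<delta>_int: "set_integrable lebesgue I (\<lambda>s. k s * \<delta> s)"
proof -
  have "I \<inter> {0..} = I" by (auto simp: time_interval_nonneg)
  then show ?thesis using tail_int[OF zero_time_interval[OF T_pos]] by simp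
qed

text \<open>Subtracting the integral over all of \<open>I\<close> turns the integral over \<open>{0..t}\<close> into one over the remaining
  time, which is small compared with \<open>\<delta> t\<close> however fast \<open>\<delta>\<close> decays. An integral from 0 would not even
  tend to 0 in general.\<close>

lemma tail_estimate:
  fixes f :: "real \<Rightarrow> 'a::{banach, second_countable_topology}"
  assumes f: "f \<in> borel_measurable (lebesgue_on I)"
    and le: "AE t in lebesgue_on I. norm (f t) \<le> b * (k t * \<delta> t)" and b: "0 \<le> b"
  shows "set_integrable lebesgue I f"
    and "t \<in> I \<Longrightarrow> norm ((LINT s:{0..t}|lebesgue. f s) - (LINT s:I|lebesgue. f s)) \<le> b * \<delta> t / 8"
proof -
  have g: "set_integrable lebesgue A (\<lambda>s. b * (k s * \<delta> s))" if "A \<in> sets lebesgue" "A \<subseteq> I" for A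
    using set_integrable_subset[OF k\<delta>_int that] by (rule set_integrable_mult_right)
  show int: "set_integrable lebesgue I f"
    by (rule set_integrable_dominated(1)[OF f _ _ g]) (use le in auto)
  assume t: "t \<in> I"
  have sub: "{0..t} \<subseteq> I" using Icc_subset_time_interval[OF t] by simp
  have eq: "{0..t} \<union> (I \<inter> {t<..}) = I" using sub by (auto simp: time_interval_nonneg)
  moreover have "(LINT s:{0..t} \<union> (I \<inter> {t<..})|lebesgue. f s)
      = (LINT s:{0..t}|lebesgue. f s) + (LINT s:I \<inter> {t<..}|lebesgue. f s)"
    using sub by (intro set_integral_Un set_integrable_subset[OF int]) auto
  ultimately have "norm ((LINT s:{0..t}|lebesgue. f s) - (LINT s:I|lebesgue. f s))
      = norm (LINT s:I \<inter> {t<..}|lebesgue. f s)" unfolding eq by simp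
  also have "\<dots> \<le> (LINT s:I \<inter> {t<..}|lebesgue. b * (k s * \<delta> s))"
    by (rule set_integrable_dominated(2)[OF f _ _ g]) (use le in auto)
  also have "\<dots> \<le> (LINT s:I \<inter> {t..}|lebesgue. b * (k s * \<delta> s))"
  proof (intro set_integral_mono_subset g)
    show "0 \<le> b * (k s * \<delta> s)" if "s \<in> I \<inter> {t..}" for s
      using mult_nonneg_nonneg[OF b less_imp_le[OF k\<delta>_pos[of s]]] that by simp
  qed auto
  also have "\<dots> = b * (LINT s:I \<inter> {t..}|lebesgue. k s * \<delta> s)" by (rule set_integral_mult_right)
  also have "\<dots> \<le> b * (\<delta> t / 8)" by (intro mult_left_mono tail_le t b)
  finally show "norm ((LINT s:{0..t}|lebesgue. f s) - (LINT s:I|lebesgue. f s)) \<le> b * \<delta> t / 8" by simp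
qed

section \<open>Filippov's iteration\<close>

text \<open>Filippov's successive approximations, in the variable \<open>v\<close> (the derivative). A velocity \<open>v\<close> determines
  the curve \<open>\<Gamma> v\<close> that starts at \<open>C v\<close>, where \<open>C v\<close> is chosen so that the difference of two such
  curves is the integral of the difference of velocities from \<open>t\<close> to the right end.
  If \<open>v\<close> has distance at most \<open>2 e k \<delta>\<close> from \<open>F t (\<Gamma> v t)\<close>, then a nearly nearest point of the dense
  sequence changes \<open>v\<close> by at most \<open>3 e k \<delta>\<close>, hence \<open>\<Gamma> v\<close> by at most \<open>3 e \<delta> / 8\<close>, and by the
  Lipschitz condition the new distance is at most \<open>e k \<delta>\<close>. The velocities converge geometrically, and
  closedness of the values of \<open>F\<close> gives an exact solution.\<close>

lemma filippov_from_right_end: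
  fixes F :: "real \<Rightarrow> 'a::{banach, second_countable_topology} \<Rightarrow> 'a set" and c :: 'a
  assumes F: "\<And>t x. t \<in> I \<Longrightarrow> closed (F t x) \<and> F t x \<noteq> {}"
    and Fm: "\<And>g x. g \<in> borel_measurable (lebesgue_on I) \<Longrightarrow>
      (\<lambda>t. infdist x (F t (g t))) \<in> borel_measurable (lebesgue_on I)"
    and lip: "AE t in lebesgue_on I. \<forall>x\<in>cball (z t) (\<delta> t). \<forall>y\<in>cball (z t) (\<delta> t).
      \<forall>u\<in>F t x. infdist u (F t y) \<le> k t * norm (x - y)"
    and v0: "L1_loc T v0"
    and start: "\<And>t. t \<in> I \<Longrightarrow> norm (c + (LINT s:{0..t}|lebesgue. v0 s) - z t) \<le> \<delta> t / 4"
    and near: "AE t in lebesgue_on I.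
      infdist (v0 t) (F t (c + (LINT s:{0..t}|lebesgue. v0 s))) \<le> 2 * (k t * \<delta> t)"
  obtains c' v where "L1_loc T v"
    and "AE t in lebesgue_on I. v t \<in> F t (c' + (LINT s:{0..t}|lebesgue. v s))"
    and "\<And>t. t \<in> I \<Longrightarrow> norm (c' + (LINT s:{0..t}|lebesgue. v s) - z t) \<le> \<delta> t"
proof -
  let ?M = "lebesgue_on I"
  note [measurable] = L1_loc_measurable[OF T_pos v0]
  obtain d :: "nat \<Rightarrow> 'a" where d: "\<And>x e. e > 0 \<Longrightarrow> \<exists>n. dist (d n) x < e"
    using dense_sequence by blast
  define C where "C = (\<lambda>v. c - (LINT s:I|lebesgue. v s - v0 s))"
  define \<Gamma> where "\<Gamma> = (\<lambda>v t. C v + (LINT s:{0..t}|lebesgue. v s))"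
  define adm where "adm = (\<lambda>v. v \<in> borel_measurable ?M \<and> (\<forall>t\<in>I. norm (v t - v0 t) \<le> 6 * (k t * \<delta> t)))"
  have \<Gamma>0: "\<Gamma> v0 t = c + (LINT s:{0..t}|lebesgue. v0 s)" for t
    by (simp add: \<Gamma>_def C_def set_lebesgue_integral_def)
  have k\<delta>_loc: "L1_loc T (\<lambda>t. k t * \<delta> t)"
  proof (rule L1_locI)
    fix t assume t: "t \<in> I"
    show "set_integrable lebesgue {0..t} (\<lambda>t. k t * \<delta> t)"
      using Icc_subset_time_interval[OF t, of 0] by (intro set_integrable_subset[OF k\<delta>_int]) auto
  qed
  have adm_loc: "L1_loc T v" if "adm v" for v
  proof (rule L1_loc_dominated)
    show "L1_loc T (\<lambda>t. norm (v0 t) + 6 * (k t * \<delta> t))"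
      using L1_loc_norm[OF v0] k\<delta>_loc by (auto simp: L1_loc_def)
    show "AE t in ?M. norm (v t) \<le> norm (v0 t) + 6 * (k t * \<delta> t)"
    proof (rule AE_I2)
      fix t assume "t \<in> space ?M"
      then have "norm (v t - v0 t) \<le> 6 * (k t * \<delta> t)" using that by (simp add: adm_def)
      then show "norm (v t) \<le> norm (v0 t) + 6 * (k t * \<delta> t)"
        using norm_triangle_sub[of "v t" "v0 t"] by simp
    qed
  qed (use that in \<open>simp add: adm_def\<close>)
  have adm0: "adm v0" using k\<delta>_pos by (auto simp: adm_def less_imp_le)
  have adm_int: "set_integrable lebesgue I (\<lambda>t. v t - v0 t)" if "adm v" for v
    using that by (intro tail_estimate(1)[where b = 6]) (auto simp: adm_def)
  have \<Gamma>_diff: "norm (\<Gamma> w t - \<Gamma> v t) \<le> b * \<delta> t / 8"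
    if "adm v" "adm w" "0 \<le> b" and le: "\<And>t. t \<in> I \<Longrightarrow> norm (w t - v t) \<le> b * (k t * \<delta> t)" and t: "t \<in> I"
    for v w b t
  proof -
    have "(LINT s:I|lebesgue. w s - v s) = (LINT s:I|lebesgue. w s - v0 s) - (LINT s:I|lebesgue. v s - v0 s)"
      using set_integral_diff(2)[OF adm_int[OF that(2)] adm_int[OF that(1)]] by simp
    moreover have "(LINT s:{0..t}|lebesgue. w s - v s) = (LINT s:{0..t}|lebesgue. w s) - (LINT s:{0..t}|lebesgue. v s)"
      by (intro set_integral_diff(2) L1_locD[OF adm_loc] that)
    ultimately have "\<Gamma> w t - \<Gamma> v t = (LINT s:{0..t}|lebesgue. w s - v s) - (LINT s:I|lebesgue. w s - v s)"
      by (simp add: \<Gamma>_def C_def)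
    moreover have "norm \<dots> \<le> b * \<delta> t / 8"
      using that by (intro tail_estimate(2)) (auto simp: adm_def)
    ultimately show ?thesis by simp
  qed
  have \<Gamma>_tube: "norm (\<Gamma> v t - z t) \<le> \<delta> t" if "adm v" "t \<in> I" for v t
  proof -
    have "norm (\<Gamma> v t - z t) \<le> norm (\<Gamma> v t - \<Gamma> v0 t) + norm (\<Gamma> v0 t - z t)"
      using norm_triangle_ineq[of "\<Gamma> v t - \<Gamma> v0 t" "\<Gamma> v0 t - z t"] by simp
    also have "\<dots> \<le> 6 * \<delta> t / 8 + \<delta> t / 4"
      using \<Gamma>_diff[OF adm0 that(1), of 6 t] that start[OF that(2)] by (intro add_mono) (auto simp: adm_def \<Gamma>0)
    finally show ?thesis by simp
  qed
  have \<Gamma>_meas: "\<Gamma> v \<in> borel_measurable ?M" if "adm v" for v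
    by (rule continuous_measurable_lebesgue_on[OF continuous_primitive[OF adm_loc[OF that], where c = "C v"]])
      (simp add: \<Gamma>_def)
  define P where "P = (\<lambda>n v. v \<in> borel_measurable ?M \<and>
    (\<forall>t\<in>I. norm (v t - v0 t) \<le> 6 * (1 - (1/2)^n) * (k t * \<delta> t)) \<and>
    (AE t in ?M. infdist (v t) (F t (\<Gamma> v t)) \<le> 2 * (1/2)^n * (k t * \<delta> t)))"
  define Q where "Q = (\<lambda>n (v :: real \<Rightarrow> 'a) w. \<forall>t\<in>I. norm (w t - v t) \<le> 3 * (1/2)^n * (k t * \<delta> t))"
  have P_adm: "adm v" if "P n v" for n v
  proof -
    have "6 * (1 - (1/2)^n) * (k t * \<delta> t) \<le> 6 * (k t * \<delta> t)" if "t \<in> I" for t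
      using k\<delta>_pos[OF that] by (intro mult_right_mono) auto
    then show ?thesis using that unfolding P_def adm_def by (meson order_trans)
  qed
  have "\<exists>V. \<forall>n. P n (V n) \<and> Q n (V n) (V (Suc n))"
  proof (rule dependent_nat_choice)
    show "\<exists>v. P 0 v"
      using near by (intro exI[of _ v0]) (auto simp: P_def \<Gamma>0)
    fix v n assume Pv: "P n v"
    have av: "adm v" by (rule P_adm[OF Pv])
    have [measurable]: "v \<in> borel_measurable ?M" using Pv by (simp add: P_def)
    have [measurable]: "(\<lambda>t. infdist x (F t (\<Gamma> v t))) \<in> borel_measurable ?M" for x
      by (rule Fm[OF \<Gamma>_meas[OF av]])
    \<comment> \<open>The index of the new velocity; where no index is admissible, which happens on a null set only, the velocity is kept.\<close>
    define R where "R = (\<lambda>m t. norm (d m - v t) < 3 * (1/2)^n * (k t * \<delta> t) \<and>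
      infdist (d m) (F t (\<Gamma> v t)) < (1/2)^Suc n * \<delta> t)"
    have Rm [measurable]: "{t \<in> space ?M. R m t} \<in> sets ?M" for m
      unfolding R_def by measurable
    obtain i where i [measurable]: "i \<in> ?M \<rightarrow>\<^sub>M count_space UNIV" and iR: "\<And>t. \<exists>m. R m t \<Longrightarrow> R (i t) t"
      using measurable_countable_choice[of ?M R, OF Rm] by blast
    define w where "w = (\<lambda>t. if R (i t) t then d (i t) else v t)"
    have [measurable]: "(\<lambda>t. d (i t)) \<in> borel_measurable ?M"
      by (rule measurable_compose[OF i]) simp
    have "(\<lambda>t. R m t) \<in> ?M \<rightarrow>\<^sub>M count_space UNIV" for m
      using Rm[of m] by (simp only: pred_def)
    then have "(\<lambda>t. R (i t) t) \<in> ?M \<rightarrow>\<^sub>M count_space UNIV"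
      using i by (rule measurable_compose_countable)
    then have wm: "w \<in> borel_measurable ?M" unfolding w_def by measurable
    have Qw: "Q n v w" unfolding Q_def
    proof
      fix t assume "t \<in> I"
      then show "norm (w t - v t) \<le> 3 * (1/2)^n * (k t * \<delta> t)"
        using k\<delta>_pos[of t] by (auto simp: w_def R_def)
    qed
    have w0: "norm (w t - v0 t) \<le> 6 * (1 - (1/2)^Suc n) * (k t * \<delta> t)" if "t \<in> I" for t
    proof -
      have "norm (w t - v0 t) \<le> norm (w t - v t) + norm (v t - v0 t)"
        using norm_triangle_ineq[of "w t - v t" "v t - v0 t"] by simp
      also have "\<dots> \<le> 3 * (1/2)^n * (k t * \<delta> t) + 6 * (1 - (1/2)^n) * (k t * \<delta> t)"
        using Qw Pv that by (intro add_mono) (auto simp: Q_def P_def)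
      also have "\<dots> = 6 * (1 - (1/2)^Suc n) * (k t * \<delta> t)" by (simp add: algebra_simps)
      finally show ?thesis .
    qed
    have aw: "adm w"
    proof -
      have "6 * (1 - (1/2)^Suc n) * (k t * \<delta> t) \<le> 6 * (k t * \<delta> t)" if "t \<in> I" for t
        using k\<delta>_pos[OF that] by (intro mult_right_mono) auto
      then show ?thesis using w0 wm unfolding adm_def by (meson order_trans)
    qed
    have "AE t in ?M. infdist (v t) (F t (\<Gamma> v t)) \<le> 2 * (1/2)^n * (k t * \<delta> t)"
      using Pv by (simp add: P_def)
    then have "AE t in ?M. infdist (w t) (F t (\<Gamma> w t)) \<le> 2 * (1/2)^Suc n * (k t * \<delta> t)"
      using lip AE_space
    proof eventually_elim
      fix t assume iv: "infdist (v t) (F t (\<Gamma> v t)) \<le> 2 * (1/2)^n * (k t * \<delta> t)"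
        and li: "\<forall>x\<in>cball (z t) (\<delta> t). \<forall>y\<in>cball (z t) (\<delta> t). \<forall>u\<in>F t x. infdist u (F t y) \<le> k t * norm (x - y)"
        and "t \<in> space ?M"
      then have t: "t \<in> I" by simp
      let ?e = "(1/2)^Suc n * \<delta> t"
      have e: "0 < ?e" using \<delta>_pos[OF t] by simp
      have "infdist (v t) (F t (\<Gamma> v t)) < 2 * (1/2)^n * (k t * \<delta> t) + ?e" using iv e by simp
      then obtain g where g: "g \<in> F t (\<Gamma> v t)" "dist (v t) g < 2 * (1/2)^n * (k t * \<delta> t) + ?e"
        using infdist_less_obtain F[OF t] by metis
      obtain m where m: "dist (d m) g < ?e" using d[OF e] by blast
      have "norm (d m - v t) \<le> dist (d m) g + dist (v t) g"
        using dist_triangle2[of "d m" "v t" g] by (simp add: dist_norm)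
      also have "\<dots> < 2 * (1/2)^n * (k t * \<delta> t) + 2 * ?e" using g m by simp
      also have "\<dots> = 2 * (1/2)^n * (k t * \<delta> t) + (1/2)^n * \<delta> t" by simp
      also have "\<dots> \<le> 2 * (1/2)^n * (k t * \<delta> t) + (1/2)^n * (k t * \<delta> t)"
        using \<delta>_le_k\<delta>[OF t] by (intro add_left_mono mult_left_mono) auto
      also have "\<dots> = 3 * (1/2)^n * (k t * \<delta> t)" by (simp add: algebra_simps)
      finally have "R m t" 
        unfolding R_def using infdist_le[OF g(1), of "d m"] m by simp
      then have "R (i t) t" using iR by blast
      then have wF: "infdist (w t) (F t (\<Gamma> v t)) < ?e" by (auto simp: w_def R_def)
      have G: "norm (\<Gamma> w t - \<Gamma> v t) \<le> 3 * (1/2)^n * \<delta> t / 8"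
        using Qw t by (intro \<Gamma>_diff[OF av aw]) (auto simp: Q_def)
      have "infdist (w t) (F t (\<Gamma> w t)) \<le> infdist (w t) (F t (\<Gamma> v t)) + k t * norm (\<Gamma> v t - \<Gamma> w t)"
        using F[OF t] li \<Gamma>_tube[OF av t] \<Gamma>_tube[OF aw t]
        by (intro infdist_le_excess) (auto simp: dist_norm norm_minus_commute)
      also have "\<dots> \<le> ?e + k t * (3 * (1/2)^n * \<delta> t / 8)"
        using wF G k_ge1[OF t] by (intro add_mono mult_left_mono) (auto simp: norm_minus_commute)
      also have "\<dots> \<le> (1/2)^Suc n * (k t * \<delta> t) + k t * (3 * (1/2)^n * \<delta> t / 8)"
        using \<delta>_le_k\<delta>[OF t] by (intro add_right_mono mult_left_mono) auto
      also have "\<dots> = (7/8) * ((1/2)^n * (k t * \<delta> t))" by (simp add: algebra_simps)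
      also have "\<dots> \<le> 1 * ((1/2)^n * (k t * \<delta> t))"
        using k\<delta>_pos[OF t] by (intro mult_right_mono) auto
      also have "\<dots> = 2 * (1/2)^Suc n * (k t * \<delta> t)" by simp
      finally show "infdist (w t) (F t (\<Gamma> w t)) \<le> 2 * (1/2)^Suc n * (k t * \<delta> t)" .
    qed
    then have "P (Suc n) w" unfolding P_def using wm w0 by blast
    then show "\<exists>w. P (Suc n) w \<and> Q n v w" using Qw by blast
  qed
  then obtain V where VP: "\<And>n. P n (V n)" and VQ: "\<And>n. Q n (V n) (V (Suc n))" by blast
  have aV: "adm (V n)" for n by (rule P_adm[OF VP])
  have "\<exists>l. (\<lambda>n. V n t) \<longlonglongrightarrow> l \<and> (\<forall>n. norm (l - V n t) \<le> 6 * (1/2)^n * (k t * \<delta> t))" if t: "t \<in> I" for t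
  proof -
    have "norm (V (Suc n) t - V n t) \<le> (3 * (k t * \<delta> t)) * (1/2)^n" for n
      using VQ[of n] t by (auto simp: Q_def mult_ac)
    then obtain l where "(\<lambda>n. V n t) \<longlonglongrightarrow> l" "\<And>n. norm (l - V n t) \<le> 2 * (3 * (k t * \<delta> t)) * (1/2)^n"
      using geometric_limit[of "\<lambda>n. V n t" "3 * (k t * \<delta> t)"] by metis
    then show ?thesis by (intro exI[of _ l]) (auto simp: mult_ac)
  qed
  then obtain v where v: "\<And>t. t \<in> I \<Longrightarrow> (\<lambda>n. V n t) \<longlonglongrightarrow> v t"
    and vV: "\<And>t n. t \<in> I \<Longrightarrow> norm (v t - V n t) \<le> 6 * (1/2)^n * (k t * \<delta> t)" by metis
  have vm: "v \<in> borel_measurable ?M"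
    by (rule borel_measurable_LIMSEQ_metric[of V]) (use v aV in \<open>auto simp: adm_def\<close>)
  have V0: "V 0 t = v0 t" if "t \<in> I" for t using VP[of 0] that by (simp add: P_def)
  have av: "adm v" unfolding adm_def using vm vV[of _ 0] V0 by auto
  have "AE t in ?M. \<forall>n. infdist (V n t) (F t (\<Gamma> (V n) t)) \<le> 2 * (1/2)^n * (k t * \<delta> t)"
    using VP by (auto simp: AE_all_countable P_def)
  then have "AE t in ?M. v t \<in> F t (\<Gamma> v t)"
    using lip AE_space
  proof eventually_elim
    fix t assume iV: "\<forall>n. infdist (V n t) (F t (\<Gamma> (V n) t)) \<le> 2 * (1/2)^n * (k t * \<delta> t)"
      and li: "\<forall>x\<in>cball (z t) (\<delta> t). \<forall>y\<in>cball (z t) (\<delta> t). \<forall>u\<in>F t x. infdist u (F t y) \<le> k t * norm (x - y)"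
      and "t \<in> space ?M"
    then have t: "t \<in> I" by simp
    have "infdist (v t) (F t (\<Gamma> v t)) \<le> (9 * (k t * \<delta> t)) * (1/2)^n" for n
    proof -
      have "norm (\<Gamma> v t - \<Gamma> (V n) t) \<le> 6 * (1/2)^n * \<delta> t / 8"
        using vV t by (intro \<Gamma>_diff[OF aV av]) auto
      then have G: "k t * norm (\<Gamma> (V n) t - \<Gamma> v t) \<le> k t * (6 * (1/2)^n * \<delta> t / 8)"
        using k_ge1[OF t] by (intro mult_left_mono) (auto simp: norm_minus_commute)
      have "infdist (v t) (F t (\<Gamma> v t)) \<le> infdist (V n t) (F t (\<Gamma> v t)) + dist (v t) (V n t)"
        by (rule infdist_triangle)
      also have "infdist (V n t) (F t (\<Gamma> v t)) \<le> infdist (V n t) (F t (\<Gamma> (V n) t)) + k t * norm (\<Gamma> (V n) t - \<Gamma> v t)"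
      proof (rule infdist_le_excess)
        show "F t (\<Gamma> (V n) t) \<noteq> {}" using F[OF t] by blast
        show "infdist a (F t (\<Gamma> v t)) \<le> k t * norm (\<Gamma> (V n) t - \<Gamma> v t)" if "a \<in> F t (\<Gamma> (V n) t)" for a
          using \<Gamma>_tube[OF av t] \<Gamma>_tube[OF aV t] that
          by (intro li[rule_format]) (auto simp: dist_norm norm_minus_commute)
      qed
      finally have "infdist (v t) (F t (\<Gamma> v t)) \<le> 2 * (1/2)^n * (k t * \<delta> t) + k t * (6 * (1/2)^n * \<delta> t / 8) + 6 * (1/2)^n * (k t * \<delta> t)"
        using iV[rule_format, of n] G vV[OF t, of n] unfolding dist_norm by linarith
      also have "\<dots> = (35/4) * ((k t * \<delta> t) * (1/2)^n)" by (simp add: algebra_simps)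
      also have "\<dots> \<le> 9 * ((k t * \<delta> t) * (1/2)^n)"
        using k\<delta>_pos[OF t] by (intro mult_right_mono) auto
      finally show ?thesis by simp
    qed
    moreover have "(\<lambda>n. (9 * (k t * \<delta> t)) * (1/2)^n) \<longlonglongrightarrow> (9 * (k t * \<delta> t)) * 0"
      by (intro tendsto_intros LIMSEQ_power_zero) auto
    ultimately have "infdist (v t) (F t (\<Gamma> v t)) \<le> (9 * (k t * \<delta> t)) * 0"
      by (intro LIMSEQ_le_const) auto
    then have "infdist (v t) (F t (\<Gamma> v t)) = 0" using infdist_nonneg[of "v t" "F t (\<Gamma> v t)"] by simp
    then show "v t \<in> F t (\<Gamma> v t)" using F[OF t] in_closed_iff_infdist_zero by blast
  qed
  then show ?thesis
    using that[of v "C v"] adm_loc[OF av] \<Gamma>_tube[OF av] by (simp add: \<Gamma>_def)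
qed

end

section \<open>Chattering\<close>

context tail_weight
begin

text \<open>A measurable choice of trees yields \<open>u\<close>, whose values are iterated midpoints of points near \<open>G t\<close>, with
  \<open>norm (u t - y t) < \<delta> t\<close>. Let \<open>J j\<close> be the level sets of the primitive of \<open>h = 32 k / \<delta>\<close>. On the part
  of \<open>J j\<close> where a given tree is chosen, \<open>u\<close> is constant and is replaced by a function alternating
  between the leaves, so that \<open>v - u\<close> has integral exactly 0 over every \<open>J j\<close>. The integral of \<open>v - u\<close>
  over \<open>{0..t}\<close> thus equals, up to sign, the integral over the rest of one piece beyond \<open>t\<close>; there
  \<open>norm (v - u) \<le> 4 k = \<delta> h / 8\<close>, \<open>\<delta>\<close> is at most \<open>\<delta> t\<close> and \<open>h\<close> has integral at most 1. The error from \<open>u - y\<close>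
  is integrated from the right end, which is where the constant \<open>c\<close> comes from.\<close>

lemma chattering_approximation:
  fixes G :: "real \<Rightarrow> 'a::{banach, second_countable_topology} set" and y :: "real \<Rightarrow> 'a"
  assumes Gm: "\<And>x. (\<lambda>t. infdist x (G t)) \<in> borel_measurable (lebesgue_on I)"
    and Gne: "\<And>t. t \<in> I \<Longrightarrow> G t \<noteq> {}"
    and y: "L1_loc T y" and yG: "AE t in lebesgue_on I. y t \<in> clco (G t)"
    and kG: "AE t in lebesgue_on I. \<forall>w\<in>G t. norm w \<le> k t"
  obtains v c where "L1_loc T v" "AE t in lebesgue_on I. infdist (v t) (G t) < \<delta> t"
    and "\<And>t. t \<in> I \<Longrightarrow> norm (c + (LINT s:{0..t}|lebesgue. v s - y s)) \<le> \<delta> t / 4"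
proof -
  let ?M = "lebesgue_on I"
  note [measurable] = Gm L1_loc_measurable[OF T_pos y]
  obtain d :: "nat \<Rightarrow> 'a" where d: "\<And>x e. e > 0 \<Longrightarrow> \<exists>n. dist (d n) x < e"
    using dense_sequence by blast
  define P where "P = (\<lambda>\<tau> t. (\<forall>n\<in>leaves \<tau>. infdist (d n) (G t) < \<delta> t) \<and> norm (mean d \<tau> - y t) < \<delta> t)"
  have Pm: "{t \<in> space ?M. P \<tau> t} \<in> sets ?M" for \<tau>
  proof -
    have "{t \<in> space ?M. \<forall>n\<in>leaves \<tau>. infdist (d n) (G t) < \<delta> t} \<in> sets ?M"
      by (rule sets.sets_Collect_finite_All[OF _ finite_leaves]) (use Gm in measurable)
    moreover have "{t \<in> space ?M. norm (mean d \<tau> - y t) < \<delta> t} \<in> sets ?M" by measurable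
    ultimately have "{t \<in> space ?M. \<forall>n\<in>leaves \<tau>. infdist (d n) (G t) < \<delta> t} \<inter>
      {t \<in> space ?M. norm (mean d \<tau> - y t) < \<delta> t} \<in> sets ?M" by (rule sets.Int)
    then show ?thesis by (rule back_subst[of "\<lambda>S. S \<in> sets ?M"]) (auto simp: P_def)
  qed
  obtain i where i [measurable]: "i \<in> ?M \<rightarrow>\<^sub>M count_space UNIV" and iP: "\<And>t. \<exists>\<tau>. P \<tau> t \<Longrightarrow> P (i t) t"
    using measurable_countable_choice[of ?M P, OF Pm] by blast
  define u where "u = (\<lambda>t. mean d (i t))"
  have [measurable]: "u \<in> borel_measurable ?M"
    unfolding u_def by (rule measurable_compose[OF i]) simp

  define h where "h = (\<lambda>t. 32 * k t / \<delta> t)"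
  have h_pos: "32 * k t \<le> h t" if "t \<in> I" for t
    using k_ge1[OF that] \<delta>_pos[OF that] \<delta>_le1[OF that]
    by (simp add: h_def field_simps mult_left_le)
  have h_loc: "L1_loc T h"
  proof (rule L1_locI)
    fix b assume b: "b \<in> I"
    have sub: "{0..b} \<subseteq> I" using Icc_subset_time_interval[OF b] by simp
    show "set_integrable lebesgue {0..b} h"
    proof (rule set_integrable_dominated(1)[OF _ _ sub])
      show "h \<in> borel_measurable ?M" unfolding h_def by measurable
      show "set_integrable lebesgue {0..b} (\<lambda>t. 32 / \<delta> b * k t)"
        by (rule set_integrable_mult_right[OF L1_locD[OF k_loc b]])
      show "AE t in ?M. t \<in> {0..b} \<longrightarrow> norm (h t) \<le> 32 / \<delta> b * k t"
      proof (intro AE_I2 impI)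
        fix t assume "t \<in> space ?M" and tb: "t \<in> {0..b}"
        then have t: "t \<in> I" by simp
        have "\<delta> b \<le> \<delta> t" using \<delta>_anti t b tb by (auto simp: monotone_on_def)
        then have "32 * k t / \<delta> t \<le> 32 * k t / \<delta> b"
          using k_ge1[OF t] \<delta>_pos[OF b] by (intro divide_left_mono) (auto intro!: mult_pos_pos \<delta>_pos t b)
        then show "norm (h t) \<le> 32 / \<delta> b * k t"
          using k_ge1[OF t] \<delta>_pos[OF t] by (simp add: h_def)
      qed
    qed simp
  qed
  have h_nn: "0 \<le> h t" if "t \<in> I" for t using h_pos[OF that] k_ge1[OF that] by simp
  define H where "H = (\<lambda>t. LINT s:{0..t}|lebesgue. h s)"
  define J where "J = (\<lambda>j::nat. {t \<in> I. nat \<lfloor>H t\<rfloor> = j})"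
  note L = level_set_integral[OF T_pos h_loc h_nn H_def J_def]
  \<comment> \<open>Since \<open>h \<ge> 1\<close>, the level sets are bounded, even when \<open>T = \<infinity>\<close>; this makes halving possible.\<close>
  have H_ge: "t \<le> H t" if t: "t \<in> I" for t
  proof -
    have "(LINT s:{0..t}|lebesgue. 1) \<le> H t"
      unfolding H_def
    proof (rule set_integral_mono)
      show "set_integrable lebesgue {0..t} (\<lambda>_. 1::real)" by (rule L1_locD[OF L1_loc_const t])
      show "set_integrable lebesgue {0..t} h" by (rule L1_locD[OF h_loc t])
      fix s assume "s \<in> {0..t}"
      then have "s \<in> I" using time_interval_down[OF t] by auto
      then show "1 \<le> h s" using h_pos[of s] k_ge1[of s] by simp
    qed
    then show ?thesis using time_interval_nonneg[OF t] by (simp add: set_lebesgue_integral_def)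
  qed
  have J_bdd: "J j \<subseteq> {0..real j + 1}" for j
  proof
    fix t assume "t \<in> J j"
    then have t: "t \<in> I" and "nat \<lfloor>H t\<rfloor> = j" by (auto simp: J_def)
    then have "H t \<le> real j + 1" by linarith
    then show "t \<in> {0..real j + 1}" using H_ge[OF t] time_interval_nonneg[OF t] by simp
  qed
  define A where "A = (\<lambda>\<tau> j. {t \<in> J j. i t = \<tau>})"
  have mA: "A \<tau> j \<in> sets lebesgue" for \<tau> j
  proof -
    have "i -` {\<tau>} \<inter> space ?M \<in> sets ?M" by (rule measurable_sets[OF i]) simp
    then have "i -` {\<tau>} \<inter> I \<in> sets lebesgue" by (subst (asm) sets_restrict_space_iff) auto
    then have "J j \<inter> (i -` {\<tau>} \<inter> I) \<in> sets lebesgue" using L(1)[of j] by (rule sets.Int[rotated])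
    also have "J j \<inter> (i -` {\<tau>} \<inter> I) = A \<tau> j" by (auto simp: A_def J_def)
    finally show ?thesis .
  qed
  have AJ: "A \<tau> j \<subseteq> J j" for \<tau> j by (auto simp: A_def)
  have "\<forall>\<tau> j. \<exists>w. w \<in> borel_measurable lebesgue \<and> (\<forall>t. w t \<in> d ` leaves \<tau>) \<and>
    set_integrable lebesgue (A \<tau> j) w \<and> (LINT t:A \<tau> j|lebesgue. w t) = measure lebesgue (A \<tau> j) *\<^sub>R mean d \<tau>"
    using mean_by_splitting[OF mA order_trans[OF AJ J_bdd]] by blast
  then obtain W where Wm: "\<And>\<tau> j. W \<tau> j \<in> borel_measurable lebesgue"
    and Wd: "\<And>\<tau> j t. W \<tau> j t \<in> d ` leaves \<tau>"
    and Wi: "\<And>\<tau> j. set_integrable lebesgue (A \<tau> j) (W \<tau> j)"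
    and WI: "\<And>\<tau> j. (LINT t:A \<tau> j|lebesgue. W \<tau> j t) = measure lebesgue (A \<tau> j) *\<^sub>R mean d \<tau>"
    by metis
  define v where "v = (\<lambda>t. W (i t) (nat \<lfloor>H t\<rfloor>) t)"
  have "H \<in> borel_measurable ?M"
    by (rule continuous_measurable_lebesgue_on[OF continuous_primitive[OF h_loc, where c = 0]]) (simp add: H_def)
  then have Hm: "(\<lambda>t. nat \<lfloor>H t\<rfloor>) \<in> ?M \<rightarrow>\<^sub>M count_space UNIV" by measurable
  have "(\<lambda>t. W \<tau> (nat \<lfloor>H t\<rfloor>) t) \<in> borel_measurable ?M" for \<tau>
    using measurable_restrict_space1[OF Wm] Hm by (rule measurable_compose_countable)
  then have vm [measurable]: "v \<in> borel_measurable ?M"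
    unfolding v_def using i by (rule measurable_compose_countable)

  have good: "AE t in ?M. P (i t) t \<and> norm (v t) \<le> 2 * k t \<and> norm (u t) \<le> 2 * k t \<and> infdist (v t) (G t) < \<delta> t"
    using yG kG AE_space
  proof eventually_elim
    fix t assume yt: "y t \<in> clco (G t)" and kt: "\<forall>w\<in>G t. norm w \<le> k t" and "t \<in> space ?M"
    then have t: "t \<in> I" by simp
    have P: "P (i t) t"
      using clco_approx_mean[OF d yt \<delta>_pos[OF t]] by (intro iP) (auto simp: P_def)
    have vd: "v t \<in> d ` leaves (i t)" unfolding v_def by (rule Wd)
    then have vG: "infdist (v t) (G t) < \<delta> t" using P by (auto simp: P_def)
    then obtain g where "g \<in> G t" "dist (v t) g < \<delta> t" using infdist_less_obtain Gne[OF t] by metis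
    then have "norm (v t) \<le> k t + \<delta> t"
      using kt norm_triangle_sub[of "v t" g] by (force simp: dist_norm)
    moreover have "norm (y t) \<le> k t" using clco_subset_cball[of "G t" "k t"] kt yt by auto
    then have "norm (u t) \<le> k t + \<delta> t"
      using P norm_triangle_sub[of "u t" "y t"] by (auto simp: P_def u_def)
    ultimately show "P (i t) t \<and> norm (v t) \<le> 2 * k t \<and> norm (u t) \<le> 2 * k t \<and> infdist (v t) (G t) < \<delta> t"
      using P vG k_ge1[OF t] \<delta>_le1[OF t] by auto
  qed

  have v_loc: "L1_loc T v"
    by (rule L1_loc_dominated[OF vm, where g = "\<lambda>t. 2 * k t"]) (use good k_loc in \<open>auto simp: L1_loc_def\<close>)
  have u_loc: "L1_loc T u"
    by (rule L1_loc_dominated[where g = "\<lambda>t. 2 * k t"]) (use good k_loc in \<open>auto simp: L1_loc_def\<close>)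
  define p where "p = (\<lambda>t. v t - u t)"
  have pm [measurable]: "p \<in> borel_measurable ?M" unfolding p_def by measurable
  have p_le: "AE t in ?M. norm (p t) \<le> 4 * k t"
    using good by eventually_elim (use norm_triangle_ineq4 in \<open>fastforce simp: p_def intro: order_trans\<close>)
  have p_loc: "L1_loc T p" unfolding p_def by (rule L1_loc_add(2)[OF v_loc u_loc])
  have p_int: "set_integrable lebesgue (J j) p" for j
  proof (rule set_integrable_dominated(1)[OF pm L(1) _ L(2)])
    show "AE t in ?M. t \<in> J j \<longrightarrow> norm (p t) \<le> h t"
      using p_le AE_space
    proof eventually_elim
      fix t assume p4: "norm (p t) \<le> 4 * k t" and "t \<in> space ?M"
      then have "t \<in> I" by simp
      then show "t \<in> J j \<longrightarrow> norm (p t) \<le> h t" using p4 h_pos[of t] k_ge1[of t] by simp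
    qed
  qed (auto simp: J_def)

  have p_zero: "(LINT t:J j|lebesgue. p t) = 0" for j
  proof -
    \<comment> \<open>Countable additivity over the trees, enumerated by their codes.\<close>
    define B where "B = (\<lambda>n::nat. {t \<in> J j. to_nat (i t) = n})"
    have Beq: "B n = (\<Union>\<tau>\<in>{\<tau>. to_nat \<tau> = n}. A \<tau> j)" for n by (auto simp: B_def A_def)
    have mB: "B n \<in> sets lebesgue" for n unfolding Beq by (intro sets.countable_UN') (auto simp: mA)
    have "(LINT t:B n|lebesgue. p t) = 0" for n
    proof (cases "\<exists>\<tau>::mtree. to_nat \<tau> = n")
      case False
      then have "B n = {}" by (auto simp: B_def)
      then show ?thesis by (simp add: set_lebesgue_integral_def)
    next
      case True
      then obtain \<tau> :: mtree where \<tau>: "to_nat \<tau> = n" by blast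
      then have BA: "B n = A \<tau> j" by (auto simp: B_def A_def)
      have fin: "A \<tau> j \<in> lmeasurable"
        by (rule bounded_set_imp_lmeasurable[OF bounded_subset[OF bounded_closed_interval order_trans[OF AJ J_bdd]] mA])
      have "(LINT t:A \<tau> j|lebesgue. p t) = (LINT t:A \<tau> j|lebesgue. W \<tau> j t - mean d \<tau>)"
        unfolding set_lebesgue_integral_def
        by (intro Bochner_Integration.integral_cong) (auto simp: indicator_def A_def J_def p_def v_def u_def)
      also have "\<dots> = (LINT t:A \<tau> j|lebesgue. W \<tau> j t) - (LINT t:A \<tau> j|lebesgue. mean d \<tau>)"
        using fin by (intro set_integral_diff(2) Wi) (auto simp: set_integrable_def fmeasurable_def)
      also have "(LINT t:A \<tau> j|lebesgue. mean d \<tau>) = measure lebesgue (A \<tau> j) *\<^sub>R mean d \<tau>"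
        using fin by (auto simp: set_lebesgue_integral_def fmeasurable_def)
      finally show ?thesis using WI BA by simp
    qed
    moreover have "(\<Union>n. B n) = J j" by (auto simp: B_def)
    moreover have "(LINT t:(\<Union>n. B n)|lebesgue. p t) = (\<Sum>n. LINT t:B n|lebesgue. p t)"
    proof (rule lebesgue_integral_countable_add)
      show "set_integrable lebesgue (\<Union>n. B n) p" using p_int[of j] calculation(2) by simp
      show "B m \<inter> B n = {}" if "m \<noteq> n" for m n using that by (auto simp: B_def)
    qed (rule mB)
    ultimately show ?thesis by simp
  qed

  have p_small: "norm (LINT s:{0..t}|lebesgue. p s) \<le> \<delta> t / 8" if t: "t \<in> I" for t
  proof -
    define n where "n = nat \<lfloor>H t\<rfloor>"
    have sub: "{0..t} \<subseteq> I" using Icc_subset_time_interval[OF t] by simp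
    have mJ [simp]: "J j \<inter> S \<in> sets lebesgue" if "S \<in> sets lebesgue" for j S
      using L(1) that by (rule sets.Int)
    have JI: "J j \<subseteq> I" for j by (auto simp: J_def)
    have subset: "J j \<subseteq> {0..t}" if "j < n" for j
    proof
      fix s assume "s \<in> J j"
      then have s: "s \<in> I" "nat \<lfloor>H s\<rfloor> = j" by (auto simp: J_def)
      have "s \<le> t"
      proof (rule ccontr)
        assume "\<not> s \<le> t"
        then have "nat \<lfloor>H t\<rfloor> \<le> nat \<lfloor>H s\<rfloor>" by (intro nat_mono floor_mono L(4) t s) auto
        then show False using s that by (simp add: n_def)
      qed
      then show "s \<in> {0..t}" using s time_interval_nonneg by auto
    qed
    have cover: "(\<Union>j\<in>{..<n}. J j) \<union> (J n \<inter> {..t}) = {0..t}"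
    proof (intro equalityI subsetI)
      fix s assume s: "s \<in> {0..t}"
      then have "s \<in> I" using sub by auto
      moreover have "nat \<lfloor>H s\<rfloor> \<le> n" unfolding n_def using s calculation
        by (intro nat_mono floor_mono L(4) t) auto
      ultimately show "s \<in> (\<Union>j\<in>{..<n}. J j) \<union> (J n \<inter> {..t})"
        using s by (cases "nat \<lfloor>H s\<rfloor> = n") (auto simp: J_def)
    qed (use subset J_bdd in fastforce)
    have int: "set_integrable lebesgue S p" if "S \<in> sets lebesgue" "S \<subseteq> J j" for S j
      by (rule set_integrable_subset[OF p_int that])
    have "(LINT s:(\<Union>j\<in>{..<n}. J j)|lebesgue. p s) = (\<Sum>j<n. LINT s:J j|lebesgue. p s)"
      using p_int L(1) by (intro set_integral_finite_Union) (auto simp: disjoint_family_on_def J_def)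
    then have z: "(LINT s:(\<Union>j\<in>{..<n}. J j)|lebesgue. p s) = 0" by (simp add: p_zero)
    have "(LINT s:(\<Union>j\<in>{..<n}. J j) \<union> (J n \<inter> {..t})|lebesgue. p s)
      = (LINT s:(\<Union>j\<in>{..<n}. J j)|lebesgue. p s) + (LINT s:J n \<inter> {..t}|lebesgue. p s)"
    proof (rule set_integral_Un)
      show "set_integrable lebesgue (\<Union>j\<in>{..<n}. J j) p"
        using p_int L(1) by (intro set_integrable_UN) auto
      show "set_integrable lebesgue (J n \<inter> {..t}) p" by (rule int[of _ n]) auto
    qed (auto simp: J_def)
    then have 1: "(LINT s:{0..t}|lebesgue. p s) = (LINT s:J n \<inter> {..t}|lebesgue. p s)"
      unfolding cover z by simp
    have "(LINT s:(J n \<inter> {..t}) \<union> (J n \<inter> {t<..})|lebesgue. p s)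
      = (LINT s:J n \<inter> {..t}|lebesgue. p s) + (LINT s:J n \<inter> {t<..}|lebesgue. p s)"
      by (intro set_integral_Un int[of _ n]) auto
    moreover have "(J n \<inter> {..t}) \<union> (J n \<inter> {t<..}) = J n" by auto
    ultimately have 2: "(LINT s:J n \<inter> {..t}|lebesgue. p s) = - (LINT s:J n \<inter> {t<..}|lebesgue. p s)"
      using p_zero[of n] by (simp add: eq_neg_iff_add_eq_0)
    have ih: "set_integrable lebesgue (J n \<inter> {t<..}) (\<lambda>s. \<delta> t / 8 * h s)"
      by (intro set_integrable_mult_right set_integrable_subset[OF L(2)]) auto
    have "norm (LINT s:J n \<inter> {t<..}|lebesgue. p s) \<le> (LINT s:J n \<inter> {t<..}|lebesgue. \<delta> t / 8 * h s)"
    proof (rule set_integrable_dominated(2)[OF pm _ _ ih])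
      show "AE s in ?M. s \<in> J n \<inter> {t<..} \<longrightarrow> norm (p s) \<le> \<delta> t / 8 * h s"
        using p_le
      proof eventually_elim
        fix s assume p4: "norm (p s) \<le> 4 * k s"
        show "s \<in> J n \<inter> {t<..} \<longrightarrow> norm (p s) \<le> \<delta> t / 8 * h s"
        proof
          assume "s \<in> J n \<inter> {t<..}"
          then have s: "s \<in> I" "t \<le> s" by (auto simp: J_def)
          have "\<delta> s \<le> \<delta> t" using \<delta>_anti s t by (auto simp: monotone_on_def)
          then have "\<delta> s / 8 * h s \<le> \<delta> t / 8 * h s" using h_nn[OF s(1)] by (intro mult_right_mono) auto
          moreover have "\<delta> s / 8 * h s = 4 * k s" using \<delta>_pos[OF s(1)] by (simp add: h_def)
          ultimately show "norm (p s) \<le> \<delta> t / 8 * h s" using p4 by simp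
        qed
      qed
    qed (use JI in auto)
    also have "\<dots> = \<delta> t / 8 * (LINT s:J n \<inter> {t<..}|lebesgue. h s)" by (rule set_integral_mult_right)
    also have "\<dots> \<le> \<delta> t / 8 * 1"
    proof (rule mult_left_mono)
      have "(LINT s:J n \<inter> {t<..}|lebesgue. h s) \<le> (LINT s:J n|lebesgue. h s)"
        using JI by (intro set_integral_mono_subset[OF L(2)]) (auto intro: h_nn)
      then show "(LINT s:J n \<inter> {t<..}|lebesgue. h s) \<le> 1" using L(3)[of n] by simp
    qed (use \<delta>_pos[OF t] in simp)
    finally show ?thesis using 1 2 by simp
  qed

  define q where "q = (\<lambda>t. u t - y t)"
  have qm: "q \<in> borel_measurable ?M" unfolding q_def by measurable
  have q_le: "AE t in ?M. norm (q t) \<le> 1 * (k t * \<delta> t)"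
    using good AE_space
  proof eventually_elim
    fix t assume "P (i t) t \<and> norm (v t) \<le> 2 * k t \<and> norm (u t) \<le> 2 * k t \<and> infdist (v t) (G t) < \<delta> t" "t \<in> space ?M"
    then show "norm (q t) \<le> 1 * (k t * \<delta> t)"
      using \<delta>_le_k\<delta>[of t] by (auto simp: q_def u_def P_def)
  qed
  show ?thesis
  proof (rule that[of v "- (LINT s:I|lebesgue. q s)"])
    show "AE t in ?M. infdist (v t) (G t) < \<delta> t" using good by eventually_elim auto
    fix t assume t: "t \<in> I"
    have q_loc: "L1_loc T q" unfolding q_def by (rule L1_loc_add(2)[OF u_loc y])
    have "(LINT s:{0..t}|lebesgue. p s + q s) = (LINT s:{0..t}|lebesgue. p s) + (LINT s:{0..t}|lebesgue. q s)"
      by (intro set_integral_add(2) L1_locD[OF _ t] p_loc q_loc)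
    moreover have "(\<lambda>s. p s + q s) = (\<lambda>s. v s - y s)" by (simp add: p_def q_def)
    ultimately have "- (LINT s:I|lebesgue. q s) + (LINT s:{0..t}|lebesgue. v s - y s)
      = (LINT s:{0..t}|lebesgue. p s) + ((LINT s:{0..t}|lebesgue. q s) - (LINT s:I|lebesgue. q s))" by simp
    also have "norm \<dots> \<le> \<delta> t / 8 + 1 * \<delta> t / 8"
      using p_small[OF t] tail_estimate(2)[OF qm q_le _ t] by (intro norm_triangle_mono) auto
    finally show "norm (- (LINT s:I|lebesgue. q s) + (LINT s:{0..t}|lebesgue. v s - y s)) \<le> \<delta> t / 4" by simp
  qed (rule v_loc)
qed

end

section \<open>Reduction to one dominating function\<close>

text \<open>The graph map \<open>t \<mapsto> (t, g t)\<close> is measurable into the product \<open>\<sigma>\<close>-algebra, and the distance from \<open>x\<close>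
  to a set is less than \<open>e\<close> exactly if the set meets the open ball of radius \<open>e\<close>.\<close>

lemma infdist_composition_measurable:
  fixes F :: "real \<Rightarrow> 'a::{banach, second_countable_topology} \<Rightarrow> 'a set"
  assumes ne: "\<And>t x. t \<in> time_interval T \<Longrightarrow> F t x \<noteq> {}"
    and F: "set_valued_measurable T F" and g: "g \<in> borel_measurable (lebesgue_on (time_interval T))"
  shows "(\<lambda>t. infdist x (F t (g t))) \<in> borel_measurable (lebesgue_on (time_interval T))"
proof (rule borel_measurableI_less)
  fix e
  let ?M = "lebesgue_on (time_interval T)"
  let ?S = "{(t, y). t \<in> time_interval T \<and> F t y \<inter> ball x e \<noteq> {}}"
  have "(\<lambda>t. (t, g t)) \<in> ?M \<rightarrow>\<^sub>M ?M \<Otimes>\<^sub>M borel"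
    using g by (intro measurable_Pair) auto
  moreover have "?S \<in> sets (?M \<Otimes>\<^sub>M borel)"
    using F unfolding set_valued_measurable_def by blast
  ultimately have "(\<lambda>t. (t, g t)) -` ?S \<inter> space ?M \<in> sets ?M"
    by (rule measurable_sets)
  also have "(\<lambda>t. (t, g t)) -` ?S \<inter> space ?M = {t \<in> space ?M. infdist x (F t (g t)) < e}"
  proof -
    have "F t (g t) \<inter> ball x e \<noteq> {} \<longleftrightarrow> infdist x (F t (g t)) < e" if "t \<in> time_interval T" for t
    proof
      assume "F t (g t) \<inter> ball x e \<noteq> {}"
      then obtain a where "a \<in> F t (g t)" "dist x a < e" by auto
      then show "infdist x (F t (g t)) < e" using infdist_le by (blast intro: le_less_trans)
    next
      assume "infdist x (F t (g t)) < e"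
      then show "F t (g t) \<inter> ball x e \<noteq> {}"
        using infdist_less_obtain[OF _ ne[OF that]] by (metis IntI empty_iff mem_ball)
    qed
    then show ?thesis by auto
  qed
  finally show "{t \<in> space ?M. infdist x (F t (g t)) < e} \<in> sets ?M" .
qed

lemma infdist_le_hausdorff_dist:
  assumes "u \<in> K" "hausdorff_dist K L \<le> ereal b"
  shows "infdist u L \<le> b"
proof -
  have "ereal (infdist u L) \<le> (SUP x\<in>K. ereal (infdist x L))" using assms(1) by (rule SUP_upper)
  also have "\<dots> \<le> ereal b" using assms(2) unfolding hausdorff_dist_def by simp
  finally show ?thesis by simp
qed

lemma L1_loc_sum:
  assumes "finite A" "\<And>i. L1_loc T (f i :: real \<Rightarrow> real)"
  shows "L1_loc T (\<lambda>t. \<Sum>i\<in>A. f i t)"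
  using assms(1)
proof induction
  case (insert a A)
  then show ?case using L1_loc_add(1)[OF assms(2)[of a] insert.IH] by simp
qed (simp add: L1_loc_const)

text \<open>Used to pass from bounds that hold on balls of fixed radius to one bound along an unbounded curve:
  on a compact subinterval only finitely many of the functions are selected.\<close>

lemma L1_loc_select:
  fixes f :: "nat \<Rightarrow> real \<Rightarrow> real"
  assumes T: "0 < T" and f: "\<And>n. L1_loc T (f n)"
    and N: "N \<in> lebesgue_on (time_interval T) \<rightarrow>\<^sub>M count_space UNIV"
    and bdd: "\<And>b. b \<in> time_interval T \<Longrightarrow> \<exists>m. \<forall>t\<in>{0..b}. N t \<le> m"
  shows "L1_loc T (\<lambda>t. \<bar>f (N t) t\<bar>)"
proof (rule L1_locI)
  fix b assume b: "b \<in> time_interval T"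
  then obtain m where m: "\<And>t. t \<in> {0..b} \<Longrightarrow> N t \<le> m" using bdd by blast
  have "(\<lambda>t. f (N t) t) \<in> borel_measurable (lebesgue_on (time_interval T))"
    using L1_loc_measurable[OF T f] N by (rule measurable_compose_countable)
  then have meas: "(\<lambda>t. \<bar>f (N t) t\<bar>) \<in> borel_measurable (lebesgue_on (time_interval T))" by measurable
  have "L1_loc T (\<lambda>t. \<Sum>n\<le>m. norm (f n t))"
    by (intro L1_loc_sum L1_loc_norm f) auto
  then have int: "set_integrable lebesgue {0..b} (\<lambda>t. \<Sum>n\<le>m. norm (f n t))"
    using b by (rule L1_locD)
  show "set_integrable lebesgue {0..b} (\<lambda>t. \<bar>f (N t) t\<bar>)"
  proof (rule set_integrable_dominated(1)[OF meas _ _ int])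
    have "\<bar>f (N t) t\<bar> \<le> (\<Sum>n\<le>m. norm (f n t))" if "t \<in> {0..b}" for t
      using member_le_sum[of "N t" "{..m}" "\<lambda>n. norm (f n t)"] m[OF that] by auto
    then show "AE t in lebesgue_on (time_interval T). t \<in> {0..b} \<longrightarrow> norm \<bar>f (N t) t\<bar> \<le> (\<Sum>n\<le>m. norm (f n t))"
      by auto
  qed (use Icc_subset_time_interval[OF b] in auto)
qed

lemma positive_antimono_minorant:
  fixes r :: "real \<Rightarrow> real"
  assumes cont: "continuous_on (time_interval T) r" and pos: "\<And>t. t \<in> time_interval T \<Longrightarrow> 0 < r t"
  obtains \<rho> where "antimono_on (time_interval T) \<rho>"
    "\<And>t. t \<in> time_interval T \<Longrightarrow> 0 < \<rho> t" "\<And>t. t \<in> time_interval T \<Longrightarrow> \<rho> t \<le> r t"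
    "\<And>t. t \<in> time_interval T \<Longrightarrow> \<rho> t \<le> 1"
proof
  define \<rho> where "\<rho> = (\<lambda>t. min 1 (Inf (r ` {0..t})))"
  have attained: "\<exists>s\<in>{0..t}. Inf (r ` {0..t}) = r s" and bdd: "bdd_below (r ` {0..t})"
    if t: "t \<in> time_interval T" for t
  proof -
    have sub: "{0..t} \<subseteq> time_interval T" using Icc_subset_time_interval[OF t] by simp
    obtain s where s: "s \<in> {0..t}" "\<And>s'. s' \<in> {0..t} \<Longrightarrow> r s \<le> r s'"
      using continuous_attains_inf[OF compact_Icc _ continuous_on_subset[OF cont sub]]
        time_interval_nonneg[OF t] by auto
    then have "Inf (r ` {0..t}) = r s" by (intro cInf_eq_minimum) auto
    then show "\<exists>s\<in>{0..t}. Inf (r ` {0..t}) = r s" using s by blast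
    show "bdd_below (r ` {0..t})" using s by (intro bdd_below.I[of _ "r s"]) auto
  qed
  show "antimono_on (time_interval T) \<rho>"
  proof (rule monotone_onI)
    fix s t assume st: "s \<in> time_interval T" "t \<in> time_interval T" "s \<le> t"
    then have "Inf (r ` {0..t}) \<le> Inf (r ` {0..s})"
      using time_interval_nonneg[OF st(1)] by (intro cInf_superset_mono bdd) auto
    then show "\<rho> s \<ge> \<rho> t" by (simp add: \<rho>_def min.coboundedI2)
  qed
  fix t assume t: "t \<in> time_interval T"
  obtain s where "s \<in> {0..t}" "Inf (r ` {0..t}) = r s" using attained[OF t] by blast
  then show "0 < \<rho> t" using pos[of s] time_interval_down[OF t] by (auto simp: \<rho>_def)
  have "Inf (r ` {0..t}) \<le> r t" using bdd[OF t] time_interval_nonneg[OF t] by (intro cInf_lower) auto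
  then show "\<rho> t \<le> r t" by (simp add: \<rho>_def)
  show "\<rho> t \<le> 1" by (simp add: \<rho>_def)
qed

section \<open>The relaxation theorem\<close>

theorem theorem3p1:
  fixes T :: ereal
    and F :: "real \<Rightarrow> 'a::{banach, second_countable_topology} \<Rightarrow> 'a set"
    and \<xi> :: 'a
    and z :: "real \<Rightarrow> 'a"
    and r :: "real \<Rightarrow> real"
  assumes T_pos: "0 < T"
    and F_values: "\<And>t x. t \<in> time_interval T \<Longrightarrow> closed (F t x) \<and> F t x \<noteq> {}"
    and H1': "set_valued_measurable T F"
    and H2': "\<And>R::real. R > 0 \<Longrightarrow> \<exists>k::real \<Rightarrow> real. L1_loc T k \<and>
        (AE t in lebesgue_on (time_interval T). \<forall>x\<in>cball 0 R. \<forall>y\<in>cball 0 R.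
           hausdorff_dist (F t x) (F t y) \<le> ereal (k t * norm (x - y)))"
    and H3': "\<And>R::real. R > 0 \<Longrightarrow> \<exists>\<alpha>::real \<Rightarrow> real. L1_loc T \<alpha> \<and>
        (AE t in lebesgue_on (time_interval T). \<forall>x\<in>cball 0 R.
           (SUP w\<in>F t x. ereal (norm w)) \<le> ereal (\<alpha> t))"
    and z_sol: "inclusion_solution T (\<lambda>t x. clco (F t x)) \<xi> z"
    and r_cont: "continuous_on (time_interval T) r"
    and r_pos: "\<And>t. t \<in> time_interval T \<Longrightarrow> r t > 0"
  shows "\<exists>\<eta>0\<in>cball \<xi> (r 0). \<exists>\<gamma>. inclusion_solution T F \<eta>0 \<gamma> \<and>
           (\<forall>t\<in>time_interval T. norm (z t - \<gamma> t) \<le> r t)"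
proof -
  let ?I = "time_interval T"
  let ?M = "lebesgue_on ?I"
  obtain y where y: "L1_loc T y" and z: "\<And>t. t \<in> ?I \<Longrightarrow> z t = \<xi> + (LINT s:{0..t}|lebesgue. y s)"
    and z0: "z 0 = \<xi>" and yF: "AE t in ?M. y t \<in> clco (F t (z t))"
    using z_sol unfolding inclusion_solution_def by auto
  have z_cont: "continuous_on ?I z" by (rule continuous_primitive[OF y z])

  have "\<forall>n::nat. \<exists>\<kappa>. L1_loc T \<kappa> \<and> (AE t in ?M. \<forall>x\<in>cball 0 (real n + 1). \<forall>x'\<in>cball 0 (real n + 1).
           hausdorff_dist (F t x) (F t x') \<le> ereal (\<kappa> t * norm (x - x')))"
    by (intro allI H2') simp
  from choice[OF this] obtain \<kappa> where "\<forall>n::nat. L1_loc T (\<kappa> n) \<and>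
      (AE t in ?M. \<forall>x\<in>cball 0 (real n + 1). \<forall>x'\<in>cball 0 (real n + 1).
           hausdorff_dist (F t x) (F t x') \<le> ereal (\<kappa> n t * norm (x - x')))" ..
  then have \<kappa>: "\<And>n. L1_loc T (\<kappa> n)"
    and \<kappa>F: "\<And>n. AE t in ?M. \<forall>x\<in>cball 0 (real n + 1). \<forall>x'\<in>cball 0 (real n + 1).
           hausdorff_dist (F t x) (F t x') \<le> ereal (\<kappa> n t * norm (x - x'))" by blast+
  have "\<forall>n::nat. \<exists>\<alpha>. L1_loc T \<alpha> \<and> (AE t in ?M. \<forall>x\<in>cball 0 (real n + 1).
           (SUP w\<in>F t x. ereal (norm w)) \<le> ereal (\<alpha> t))"
    by (intro allI H3') simp
  from choice[OF this] obtain \<alpha> where "\<forall>n::nat. L1_loc T (\<alpha> n) \<and>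
      (AE t in ?M. \<forall>x\<in>cball 0 (real n + 1). (SUP w\<in>F t x. ereal (norm w)) \<le> ereal (\<alpha> n t))" ..
  then have \<alpha>: "\<And>n. L1_loc T (\<alpha> n)"
    and \<alpha>F: "\<And>n. AE t in ?M. \<forall>x\<in>cball 0 (real n + 1).
           (SUP w\<in>F t x. ereal (norm w)) \<le> ereal (\<alpha> n t)" by blast+

  \<comment> \<open>The ball of radius \<open>N t + 1\<close> contains the tube of width \<open>r t\<close> around \<open>z t\<close>, and \<open>N\<close> is bounded on compact intervals.\<close>
  define N where "N = (\<lambda>t. nat \<lceil>norm (z t) + r t\<rceil>)"
  have nz_cont: "continuous_on ?I (\<lambda>t. norm (z t) + r t)"
    by (intro continuous_intros z_cont r_cont)
  have Nm: "N \<in> ?M \<rightarrow>\<^sub>M count_space UNIV"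
    using continuous_measurable_lebesgue_on[OF nz_cont] unfolding N_def by measurable
  have Nbdd: "\<exists>m. \<forall>t\<in>{0..b}. N t \<le> m" if b: "b \<in> ?I" for b
  proof -
    have sub: "{0..b} \<subseteq> ?I" using Icc_subset_time_interval[OF b] by simp
    obtain s where "\<forall>t\<in>{0..b}. norm (z t) + r t \<le> norm (z s) + r s"
      using continuous_attains_sup[OF compact_Icc _ continuous_on_subset[OF nz_cont sub]]
        time_interval_nonneg[OF b] by auto
    then have "\<forall>t\<in>{0..b}. N t \<le> N s" unfolding N_def by (intro ballI nat_mono ceiling_mono) blast
    then show ?thesis by blast
  qed
  have tube: "x \<in> cball 0 (real (N t) + 1)" if "t \<in> ?I" "x \<in> cball (z t) (r t)" for t x
  proof -
    have "norm x \<le> norm (z t) + r t"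
      using that(2) norm_triangle_sub[of x "z t"] by (simp add: dist_norm norm_minus_commute)
    also have "\<dots> \<le> real (N t)" unfolding N_def by linarith
    finally show ?thesis by (simp add: dist_norm)
  qed

  define k where "k = (\<lambda>t. 1 + (\<bar>\<kappa> (N t) t\<bar> + \<bar>\<alpha> (N t) t\<bar>))"
  have k_loc: "L1_loc T k" unfolding k_def
    by (intro L1_loc_add(1) L1_loc_const L1_loc_select T_pos \<kappa> \<alpha> Nm Nbdd)
  have k1: "1 \<le> k t" for t by (simp add: k_def)
  have "AE t in ?M. \<forall>n. \<forall>x\<in>cball 0 (real n + 1). \<forall>x'\<in>cball 0 (real n + 1).
           hausdorff_dist (F t x) (F t x') \<le> ereal (\<kappa> n t * norm (x - x'))"
    using \<kappa>F by (simp add: AE_all_countable)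
  then have lip: "AE t in ?M. \<forall>x\<in>cball (z t) (r t). \<forall>x'\<in>cball (z t) (r t).
      \<forall>u\<in>F t x. infdist u (F t x') \<le> k t * norm (x - x')"
    using AE_space
  proof eventually_elim
    fix t assume H: "\<forall>n. \<forall>x\<in>cball 0 (real n + 1). \<forall>x'\<in>cball 0 (real n + 1).
        hausdorff_dist (F t x) (F t x') \<le> ereal (\<kappa> n t * norm (x - x'))" and "t \<in> space ?M"
    then have t: "t \<in> ?I" by simp
    show "\<forall>x\<in>cball (z t) (r t). \<forall>x'\<in>cball (z t) (r t). \<forall>u\<in>F t x. infdist u (F t x') \<le> k t * norm (x - x')"
    proof (intro ballI)
      fix x x' u assume x: "x \<in> cball (z t) (r t)" "x' \<in> cball (z t) (r t)" and u: "u \<in> F t x"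
      have "infdist u (F t x') \<le> \<kappa> (N t) t * norm (x - x')"
        using H tube[OF t] x by (intro infdist_le_hausdorff_dist[OF u]) blast
      also have "\<dots> \<le> k t * norm (x - x')" unfolding k_def by (intro mult_right_mono) auto
      finally show "infdist u (F t x') \<le> k t * norm (x - x')" .
    qed
  qed
  have "AE t in ?M. \<forall>n. \<forall>x\<in>cball 0 (real n + 1). (SUP w\<in>F t x. ereal (norm w)) \<le> ereal (\<alpha> n t)"
    using \<alpha>F by (simp add: AE_all_countable)
  then have growth: "AE t in ?M. \<forall>w\<in>F t (z t). norm w \<le> k t"
    using AE_space
  proof eventually_elim
    fix t assume H: "\<forall>n. \<forall>x\<in>cball 0 (real n + 1). (SUP w\<in>F t x. ereal (norm w)) \<le> ereal (\<alpha> n t)"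
      and "t \<in> space ?M"
    then have t: "t \<in> ?I" by simp
    have le: "(SUP w\<in>F t (z t). ereal (norm w)) \<le> ereal (\<alpha> (N t) t)"
      using H tube[OF t, of "z t"] r_pos[OF t] by auto
    show "\<forall>w\<in>F t (z t). norm w \<le> k t"
    proof
      fix w assume "w \<in> F t (z t)"
      then have "ereal (norm w) \<le> ereal (\<alpha> (N t) t)" by (rule order_trans[OF SUP_upper le])
      then show "norm w \<le> k t" by (simp add: k_def)
    qed
  qed

  obtain \<rho> where \<rho>: "antimono_on ?I \<rho>" "\<And>t. t \<in> ?I \<Longrightarrow> 0 < \<rho> t"
    and \<rho>r: "\<And>t. t \<in> ?I \<Longrightarrow> \<rho> t \<le> r t" "\<And>t. t \<in> ?I \<Longrightarrow> \<rho> t \<le> 1"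
    using positive_antimono_minorant[OF r_cont r_pos] by blast
  obtain \<delta> where \<delta>: "antimono_on ?I \<delta>" "\<And>t. t \<in> ?I \<Longrightarrow> 0 < \<delta> t \<and> \<delta> t \<le> \<rho> t"
    "\<And>t. t \<in> ?I \<Longrightarrow> set_integrable lebesgue (?I \<inter> {t..}) (\<lambda>s. k s * \<delta> s)"
    "\<And>t. t \<in> ?I \<Longrightarrow> (LINT s:?I \<inter> {t..}|lebesgue. k s * \<delta> s) \<le> \<delta> t / 8"
    using decaying_weight[OF T_pos k_loc order_trans[OF zero_le_one k1] \<rho>] by blast
  interpret tail_weight T k \<delta>
  proof
    show "\<delta> t \<le> 1" if "t \<in> ?I" for t using \<delta>(2)[OF that] \<rho>r(2)[OF that] by simp
  qed (use T_pos k_loc k1 \<delta> in auto)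
  have \<delta>r: "\<delta> t \<le> r t" if "t \<in> ?I" for t using \<delta>(2)[OF that] \<rho>r(1)[OF that] by simp

  have F_meas: "(\<lambda>t. infdist x (F t (g t))) \<in> borel_measurable ?M" if "g \<in> borel_measurable ?M" for g x
    by (rule infdist_composition_measurable[OF _ H1' that]) (use F_values in blast)
  obtain v0 c where v0: "L1_loc T v0" and v0F: "AE t in ?M. infdist (v0 t) (F t (z t)) < \<delta> t"
    and c: "\<And>t. t \<in> ?I \<Longrightarrow> norm (c + (LINT s:{0..t}|lebesgue. v0 s - y s)) \<le> \<delta> t / 4"
    using chattering_approximation[OF F_meas[OF continuous_measurable_lebesgue_on[OF z_cont]] _ y yF growth]
      F_values by blast
  \<comment> \<open>The first approximation: it moves with the chattering velocity and starts at \<open>\<xi> + c\<close>.\<close>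
  have start: "norm (\<xi> + c + (LINT s:{0..t}|lebesgue. v0 s) - z t) \<le> \<delta> t / 4" if t: "t \<in> ?I" for t
    using c[OF t] z[OF t] set_integral_diff(2)[OF L1_locD[OF v0 t] L1_locD[OF y t]]
    by (simp add: algebra_simps)
  have tube_lip: "AE t in ?M. \<forall>x\<in>cball (z t) (\<delta> t). \<forall>x'\<in>cball (z t) (\<delta> t).
      \<forall>u\<in>F t x. infdist u (F t x') \<le> k t * norm (x - x')"
    using lip AE_space
  proof eventually_elim
    fix t assume H: "\<forall>x\<in>cball (z t) (r t). \<forall>x'\<in>cball (z t) (r t).
      \<forall>u\<in>F t x. infdist u (F t x') \<le> k t * norm (x - x')" and "t \<in> space ?M"
    then have "cball (z t) (\<delta> t) \<subseteq> cball (z t) (r t)" using \<delta>r[of t] by (intro subset_cball) simp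
    then show "\<forall>x\<in>cball (z t) (\<delta> t). \<forall>x'\<in>cball (z t) (\<delta> t).
      \<forall>u\<in>F t x. infdist u (F t x') \<le> k t * norm (x - x')" using H by blast
  qed
  have near: "AE t in ?M. infdist (v0 t) (F t (\<xi> + c + (LINT s:{0..t}|lebesgue. v0 s))) \<le> 2 * (k t * \<delta> t)"
    using tube_lip v0F AE_space
  proof eventually_elim
    fix t assume H: "\<forall>x\<in>cball (z t) (\<delta> t). \<forall>x'\<in>cball (z t) (\<delta> t).
      \<forall>u\<in>F t x. infdist u (F t x') \<le> k t * norm (x - x')"
      and v: "infdist (v0 t) (F t (z t)) < \<delta> t" and "t \<in> space ?M"
    then have t: "t \<in> ?I" by simp
    let ?x = "\<xi> + c + (LINT s:{0..t}|lebesgue. v0 s)"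
    have x: "norm (z t - ?x) \<le> \<delta> t / 4" using start[OF t] by (simp add: norm_minus_commute)
    have "infdist (v0 t) (F t ?x) \<le> infdist (v0 t) (F t (z t)) + k t * norm (z t - ?x)"
    proof (rule infdist_le_excess)
      show "F t (z t) \<noteq> {}" using F_values[OF t] by blast
      show "infdist a (F t ?x) \<le> k t * norm (z t - ?x)" if "a \<in> F t (z t)" for a
        using x \<delta>_pos[OF t] that by (intro H[rule_format]) (auto simp: dist_norm)
    qed
    also have "\<dots> \<le> k t * \<delta> t + k t * (\<delta> t / 4)"
      using v \<delta>_le_k\<delta>[OF t] x k1[of t] by (intro add_mono mult_left_mono) auto
    also have "\<dots> \<le> 2 * (k t * \<delta> t)" using k\<delta>_pos[OF t] by (simp add: mult.commute)
    finally show "infdist (v0 t) (F t ?x) \<le> 2 * (k t * \<delta> t)" .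
  qed
  obtain c' v where v: "L1_loc T v"
    and vF: "AE t in ?M. v t \<in> F t (c' + (LINT s:{0..t}|lebesgue. v s))"
    and close: "\<And>t. t \<in> ?I \<Longrightarrow> norm (c' + (LINT s:{0..t}|lebesgue. v s) - z t) \<le> \<delta> t"
    using filippov_from_right_end[OF F_values F_meas tube_lip v0 start near] by blast
  define \<gamma> where "\<gamma> = (\<lambda>t. c' + (LINT s:{0..t}|lebesgue. v s))"
  have \<gamma>0: "\<gamma> 0 = c'" by (simp add: \<gamma>_def)
  have \<gamma>z: "norm (z t - \<gamma> t) \<le> r t" if "t \<in> ?I" for t
    using close[OF that] \<delta>r[OF that] unfolding \<gamma>_def by (simp add: norm_minus_commute)
  have "inclusion_solution T F c' \<gamma>"
    unfolding inclusion_solution_def using v vF \<gamma>0 by (intro conjI exI[of _ v]) (auto simp: \<gamma>_def)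
  moreover have "c' \<in> cball \<xi> (r 0)"
    using \<gamma>z[OF zero_time_interval[OF T_pos]] by (simp add: \<gamma>0 z0 dist_norm)
  ultimately show ?thesis using \<gamma>z by blast
qed

end
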